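(* Let $\eta>0$ and let $m,d$ be positive integers. Then there exists a positive integer $n_3=n_3(\eta,m,d)$ such that for every integer $n\geq n_3$ and every $d$-integer polynomial $Q\colon\mathbb{F}_2^{\binom{[n]}{\leq 2}}\to\mathbb{Z}_{2^d}$ of degree at most $d$, there exists a collection $\mathcal{V}$ of pairwise disjoint $m$-dimensional block HJ-subspaces of $\mathbb{F}_2^{\binom{[n]}{\leq 2}}$ such that (i) $\mathbb{P}\big[\mathbb{F}_2^{\binom{[n]}{\leq 2}}\setminus\bigcup\mathcal{V}\big]\leq\eta$, and (ii) for every $V\in\mathcal{V}$, $Q$ is constant on $V$.
   Context: $\binom{[n]}{\leq 2}$ is the set of nonempty subsets of $[n]$ with at most two elements; $\mathbb{P}$ is the uniform probability measure on $\mathbb{F}_2^{\binom{[n]}{\leq 2}}$; $\mathbb{Z}_{2^k}=\mathbb{Z}/2^k\mathbb{Z}$. Integer polynomial: a function $Q\colon\mathbb{F}_2^{\binom{[n]}{\leq 2}}\to\mathbb{Z}_{2^k}$ is a $k$-integer polynomial of degree at most $d$ if $Q(x)=\alpha+\sum_{F}\lambda_F\prod_{e\in F}x(e)\bmod 2^k$, the sum over nonempty $F\subseteq\binom{[n]}{\leq 2}$ with $|F|\leq d$, with $\alpha,\lambda_F\in\mathbb{Z}_{2^k}$ and $x(e)\in\{0,1\}\subseteq\mathbb{Z}_{2^k}$. HJ-subspaces: let $n\geq m\geq 1$ and let $\boldsymbol{I}=(I_1,\dots,I_m)$ be pairwise disjoint nonempty subsets of $[n]$ with $\min I_1<\dots<\min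 I_m$. For $q\in\binom{[m]}{\leq 2}$ let $b_q\in\mathbb{F}_2^{\binom{[n]}{\leq 2}}$ be the indicator of $\{p\in\binom{[n]}{\leq 2}: p\subseteq\bigcup_{i\in q}I_i \text{ and } p\cap I_i\neq\emptyset\ \forall i\in q\}$, and $\mathrm{Id}_{\boldsymbol I}(x)=\sum_{q}x(q)b_q$ for $x\in\mathbb{F}_2^{\binom{[m]}{\leq 2}}$. An HJ-embedding is a map $e=\mathrm{Id}_{\boldsymbol I}+c$ where $c\in\mathbb{F}_2^{\binom{[n]}{\leq 2}}$ vanishes on $\binom{I_1\cup\dots\cup I_m}{\leq 2}$; its image is an HJ-subspace of dimension $m$ with wildcard sets $\boldsymbol I$. It is block if $\max I_i<\min I_{i+1}$ for all $i<m$. *)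

theory Defs
  imports "HOL-Analysis.Analysis"
begin

definition pairs :: "nat \<Rightarrow> nat set set" where
  "pairs n = {p. p \<subseteq> {1..n} \<and> p \<noteq> {} \<and> card p \<le> 2}"

text \<open>Points of F_2^(binom([n], <= 2)): boolean functions supported on pairs n.\<close>
definition cube :: "nat \<Rightarrow> (nat set \<Rightarrow> bool) set" where
  "cube n = {x. \<forall>p. p \<notin> pairs n \<longrightarrow> \<not> x p}"

definition prob_cube :: "nat \<Rightarrow> (nat set \<Rightarrow> bool) set \<Rightarrow> real" where
  "prob_cube n S = real (card (S \<inter> cube n)) / 2 ^ card (pairs n)"

text \<open>k-integer polynomials of degree at most d; values in Z_{2^k} represented
  by the residues {0..<2^k}.\<close>
definition int_poly :: "nat \<Rightarrow> nat \<Rightarrow> nat \<Rightarrow> ((nat set \<Rightarrow> bool) \<Rightarrow> int) \<Rightarrow> bool" where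
  "int_poly n k d Q \<longleftrightarrow> (\<exists>(\<alpha>::int) (coef::nat set set \<Rightarrow> int).
     \<forall>x\<in>cube n. Q x = (\<alpha> + (\<Sum>F\<in>{F. F \<subseteq> pairs n \<and> F \<noteq> {} \<and> card F \<le> d}.
        coef F * (\<Prod>e\<in>F. if x e then 1 else 0))) mod 2 ^ k)"

definition wildcards :: "nat \<Rightarrow> nat \<Rightarrow> (nat \<Rightarrow> nat set) \<Rightarrow> bool" where
  "wildcards n m I \<longleftrightarrow>
     (\<forall>i\<in>{1..m}. I i \<noteq> {} \<and> I i \<subseteq> {1..n}) \<and>
     (\<forall>i\<in>{1..m}. \<forall>j\<in>{1..m}. i \<noteq> j \<longrightarrow> I i \<inter> I j = {}) \<and>
     (\<forall>i\<in>{1..m}. \<forall>j\<in>{1..m}. i < j \<longrightarrow> Min (I i) < Min (I j))"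

definition block_wildcards :: "nat \<Rightarrow> (nat \<Rightarrow> nat set) \<Rightarrow> bool" where
  "block_wildcards m I \<longleftrightarrow> (\<forall>i\<in>{1..<m}. Max (I i) < Min (I (Suc i)))"

definition bvec :: "(nat \<Rightarrow> nat set) \<Rightarrow> nat set \<Rightarrow> nat set \<Rightarrow> bool" where
  "bvec I q p \<longleftrightarrow> p \<noteq> {} \<and> card p \<le> 2 \<and> p \<subseteq> (\<Union>i\<in>q. I i) \<and> (\<forall>i\<in>q. p \<inter> I i \<noteq> {})"

text \<open>Id_I(x) = sum over q of x(q) b_q, sum in F_2 (parity of number of true terms).\<close>
definition Id_emb :: "nat \<Rightarrow> (nat \<Rightarrow> nat set) \<Rightarrow> (nat set \<Rightarrow> bool) \<Rightarrow> nat set \<Rightarrow> bool" where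
  "Id_emb m I x p \<longleftrightarrow> odd (card {q \<in> pairs m. x q \<and> bvec I q p})"

text \<open>HJ-embedding e = Id_I + c.\<close>
definition hj_emb :: "nat \<Rightarrow> (nat \<Rightarrow> nat set) \<Rightarrow> (nat set \<Rightarrow> bool) \<Rightarrow> (nat set \<Rightarrow> bool) \<Rightarrow> nat set \<Rightarrow> bool" where
  "hj_emb m I c x p \<longleftrightarrow> (Id_emb m I x p \<noteq> c p)"

definition block_hj_subspace :: "nat \<Rightarrow> nat \<Rightarrow> (nat set \<Rightarrow> bool) set \<Rightarrow> bool" where
  "block_hj_subspace n m V \<longleftrightarrow> 1 \<le> m \<and> m \<le> n \<and>
     (\<exists>I c. wildcards n m I \<and> block_wildcards m I \<and> c \<in> cube n \<and>
        (\<forall>p\<in>pairs n. p \<subseteq> (\<Union>i\<in>{1..m}. I i) \<longrightarrow> \<not> c p) \<and>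
        V = hj_emb m I c ` cube m)"

end

theory Submission
  imports Defs "HOL-Library.Ramsey"
begin

text \<open>
  The degree of \<open>Q\<close> is lowered one step at a time. Write \<open>q = 2^d\<close> and \<open>t\<close> for the current
  degree. By Ramsey's theorem for \<open>2t\<close>-sets, every long enough interval of \<open>[n]\<close> contains a set \<open>M\<close>
  of bounded size on which the degree-\<open>t\<close> coefficients modulo \<open>q\<close> depend only on the order type of
  the monomial. Cut \<open>M\<close> into consecutive blocks of size \<open>s = q (2t)!\<close>. A degree-\<open>t\<close> coefficient of
  the restriction of \<open>Q\<close> to a subspace with these wildcard sets is a sum of degree-\<open>t\<close>
  coefficients of \<open>Q\<close>, hence a combination of binomial coefficients \<open>s choose j\<close> with
  \<open>1 \<le> j \<le> 2t\<close>, all of which are divisible by \<open>q\<close>. This happens whatever the fixed part \<open>c\<close> is,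
  so such an \<open>M\<close> catches a proportion of the cube that does not depend on \<open>n\<close>, and using many
  disjoint intervals independently one covers almost everything by subspaces on which the degree of
  \<open>Q\<close> is at most \<open>t - 1\<close>. Subspaces of subspaces are subspaces, so induction on the degree
  finishes the proof.
\<close>

section \<open>Order-homogeneous sets\<close>

text \<open>Transport of Ramsey's theorem along two bijections: the colours \<open>C\<close> are
  numbered by \<open>g\<close>, and \<open>h\<close> identifies an initial segment of the naturals
  with part of \<open>B\<close>.\<close>

lemma ramsey_finite_colours:
  fixes C :: "'b set"
  assumes "finite C"
  shows "\<exists>N. \<forall>(B::'a set) f. finite B \<longrightarrow> N \<le> card B \<longrightarrow> f \<in> nsets B r \<rightarrow> C \<longrightarrow>
    (\<exists>M c. M \<subseteq> B \<and> card M = q \<and> (\<forall>X\<in>nsets M r. f X = c))"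
proof -
  obtain g where g: "bij_betw g C {..<card C}"
    using assms ex_bij_betw_finite_nat[of C] by (auto simp: lessThan_atLeast0)
  \<comment> \<open>Every colour has the same target size \<open>q\<close>, so the size of the
    homogeneous set does not depend on which colour it gets.\<close>
  obtain N :: nat where N: "partn_lst {..<N} (replicate (card C) q) r"
    using ramsey_full by blast
  show ?thesis
  proof (intro exI[of _ N] allI impI)
    fix B :: "'a set" and f
    assume B: "finite B" "N \<le> card B" and f: "f \<in> nsets B r \<rightarrow> C"
    obtain h where h: "bij_betw h {..<card B} B"
      using B(1) ex_bij_betw_nat_finite[of B] by (auto simp: lessThan_atLeast0)
    then have inj: "inj_on h {..<N}" and im: "h ` {..<N} \<subseteq> B"
      using B(2) by (auto simp: bij_betw_def inj_on_def)
    have "(\<lambda>X. h ` X) \<in> nsets {..<N} r \<rightarrow> nsets B r"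
      using im inj by (intro nsets_image_funcset) auto
    then have "(\<lambda>X. g (f (h ` X))) \<in> nsets {..<N} r \<rightarrow> {..<card C}"
      using f g by (auto simp: bij_betw_def Pi_iff)
    with N obtain i K where K: "K \<in> nsets {..<N} (replicate (card C) q ! i)" and i: "i < card C"
      and mono: "(\<lambda>X. g (f (h ` X))) ` nsets K r \<subseteq> {i}"
      by (auto simp: partn_lst_def monochromatic_def)
    have K': "K \<subseteq> {..<N}" "card K = q"
      using K i by (auto simp: nsets_def)
    have injK: "inj_on h K"
      using inj K'(1) inj_on_subset by blast
    have "f X = inv_into C g i" if "X \<in> nsets (h ` K) r" for X
    proof -
      obtain Y where Y: "Y \<in> nsets K r" "X = h ` Y"
        using nset_image_obtains[OF \<open>X \<in> _\<close> injK] .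
      have "X \<in> nsets B r"
        using that K' im nsets_mono[of "h ` K" B r] by blast
      then have "f X \<in> C" using f by auto
      moreover have "g (f X) = i" using mono Y by auto
      ultimately show ?thesis
        using g by (metis bij_betw_def inv_into_f_f)
    qed
    moreover have "h ` K \<subseteq> B" using K' im by auto
    moreover have "card (h ` K) = q" using K' injK by (simp add: card_image)
    ultimately show "\<exists>M c. M \<subseteq> B \<and> card M = q \<and> (\<forall>X\<in>nsets M r. f X = c)"
      by blast
  qed
qed

text \<open>Increasing enumeration commutes with order-preserving maps. This lets a pattern of
  positions be carried from a vertex set to its image.\<close>

lemma sorted_list_of_set_strict_mono_image:
  fixes h :: "'a::linorder \<Rightarrow> 'b::linorder"
  assumes "finite X" "strict_mono_on X h"
  shows "sorted_list_of_set (h ` X) = map h (sorted_list_of_set X)"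
proof -
  have "sorted_wrt (\<lambda>x y. h x < h y) (sorted_list_of_set X)"
    by (rule sorted_wrt_mono_rel[OF _ strict_sorted_list_of_set])
       (use assms in \<open>auto simp: strict_mono_on_def\<close>)
  moreover have "card (h ` X) = card X"
    using assms by (intro card_image strict_mono_on_imp_inj_on)
  ultimately show ?thesis
    using assms(1)
    by (subst sorted_list_of_set_unique[symmetric]) (auto simp: sorted_wrt_map)
qed

lemma image_image_cong_on:
  "(\<And>x. x \<in> \<Union>F \<Longrightarrow> f x = g x) \<Longrightarrow> (`) f ` F = (`) g ` F"
  by (intro image_cong refl) (auto simp: image_iff)

text \<open>An \<open>r\<close>-set \<open>X\<close> is coloured by the whole table of residues of
  \<open>coef\<close> on set systems over \<open>X\<close>. The table is indexed by set systems over
  \<open>{..<r}\<close>, read through the increasing enumeration of \<open>X\<close>. Modulo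
  \<open>q\<close> there are only finitely many tables, and on a homogeneous set the residue of
  \<open>coef F\<close> depends only on the positions that \<open>F\<close> occupies.\<close>

lemma order_homogeneous_subset:
  fixes q :: int
  assumes "q > 0"
  shows "\<exists>N. \<forall>(B::nat set) coef. finite B \<longrightarrow> N \<le> card B \<longrightarrow>
       (\<exists>M\<subseteq>B. card M = L \<and>
         (\<forall>F h. F \<subseteq> Pow M \<longrightarrow> card (\<Union>F) \<le> r \<longrightarrow> strict_mono_on (\<Union>F) h \<longrightarrow> h ` \<Union>F \<subseteq> M
            \<longrightarrow> coef ((`) h ` F) mod q = coef F mod q))"
proof -
  define C where "C = PiE (Pow (Pow {..<r})) (\<lambda>_. {0..<q})"
  have "finite C" by (auto simp: C_def intro!: finite_PiE)
  from ramsey_finite_colours[OF this]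
  obtain N where N: "\<forall>(B::nat set) f. finite B \<longrightarrow> N \<le> card B \<longrightarrow> f \<in> nsets B r \<rightarrow> C \<longrightarrow>
      (\<exists>M c. M \<subseteq> B \<and> card M = L + r \<and> (\<forall>X\<in>nsets M r. f X = c))"
    ..
  show ?thesis
  proof (intro exI[of _ N] allI impI)
    fix B :: "nat set" and coef :: "nat set set \<Rightarrow> int"
    assume B: "finite B" "N \<le> card B"
    define e where "e X i = sorted_list_of_set X ! i" for X :: "nat set" and i
    define f where "f X = (\<lambda>S\<in>Pow (Pow {..<r}). coef ((`) (e X) ` S) mod q)" for X
    have "f X \<in> C" for X
      unfolding f_def C_def by (rule restrict_PiE_iff[THEN iffD2]) (use assms in simp)
    then have "f \<in> nsets B r \<rightarrow> C" by (rule Pi_I)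
    with B have "\<exists>M c. M \<subseteq> B \<and> card M = L + r \<and> (\<forall>X\<in>nsets M r. f X = c)"
      by (intro N[rule_format])
    then obtain M0 c where M0: "M0 \<subseteq> B" "card M0 = L + r"
      and col: "\<And>X. X \<in> nsets M0 r \<Longrightarrow> f X = c" by blast
    have "finite M0" using B(1) M0(1) finite_subset by blast
    then obtain g where g: "bij_betw g {..<L + r} M0" "strict_mono_on {..<L + r} g"
      using ex_bij_betw_strict_mono_card M0(2) by metis
    define M where "M = g ` {..<L}"
    define T where "T = g ` {L..<L + r}"
    have inj: "inj_on g {..<L + r}" using g by (simp add: bij_betw_def)
    have MT: "M \<subseteq> M0" "T \<subseteq> M0" using g by (auto simp: M_def T_def bij_betw_def)
    have "inj_on g {..<L}" "inj_on g {L..<L + r}"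
      by (rule inj_on_subset[OF inj], force)+
    then have card: "card M = L" "card T = r"
      by (simp_all add: M_def T_def card_image)
    have less: "a < t" if at: "a \<in> M" "t \<in> T" for a t
    proof -
      obtain i where "i < L" "a = g i" using at(1) by (auto simp: M_def)
      moreover obtain j where "L \<le> j" "j < L + r" "t = g j" using at(2) by (auto simp: T_def)
      ultimately show ?thesis using strict_mono_onD[OF g(2), of i j] by simp
    qed
    \<comment> \<open>The \<open>r\<close> points of \<open>T\<close> lie above \<open>M\<close> and pad vertex sets with fewer than \<open>r\<close> elements.\<close>
    have "coef ((`) h ` F) mod q = coef F mod q"
      if F: "F \<subseteq> Pow M" "card (\<Union>F) \<le> r" and h: "strict_mono_on (\<Union>F) h" "h ` \<Union>F \<subseteq> M" for F h
    proof -
      define V where "V = \<Union>F"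
      have "V \<subseteq> M" using F by (auto simp: V_def)
      have fin: "finite M" "finite T" "finite V"
        using \<open>finite M0\<close> MT \<open>V \<subseteq> M\<close> by (auto intro: finite_subset)
      obtain T' where T': "T' \<subseteq> T" "card T' = r - card V"
        using obtain_subset_with_card_n[of "r - card V" T] card(2) by (metis diff_le_self)
      have "finite T'" using T' fin finite_subset by blast
      have disj: "V \<inter> T' = {}" using less \<open>V \<subseteq> M\<close> T' by blast
      define X where "X = V \<union> T'"
      have cX: "card X = r" "finite X"
        using disj fin \<open>finite T'\<close> T' F(2) by (auto simp: X_def card_Un_disjoint V_def)
      \<comment> \<open>The padding is left in place. Since it lies above all of \<open>M\<close>,
        the extended map is still strictly increasing, and \<open>X\<close> and its image under
        \<open>h'\<close> are two \<open>r\<close>-sets of the same colour.\<close>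
      define h' where "h' v = (if v \<in> V then h v else v)" for v
      have hM: "h v \<in> M" if "v \<in> V" for v using h(2) that by (auto simp: V_def)
      have sm: "strict_mono_on X h'"
      proof (rule strict_mono_onI)
        fix u v assume uv: "u \<in> X" "v \<in> X" "u < v"
        consider "u \<in> V" "v \<in> V" | "u \<in> V" "v \<in> T'" | "u \<in> T'" "v \<in> V" | "u \<in> T'" "v \<in> T'"
          using uv by (auto simp: X_def)
        then show "h' u < h' v"
        proof cases
          case 1 then show ?thesis using h(1) uv by (auto simp: h'_def V_def strict_mono_on_def)
        next
          case 2 then show ?thesis using disj hM less T' by (auto simp: h'_def)
        next
          case 3 then have "v < u" using less \<open>V \<subseteq> M\<close> T' by auto
          then show ?thesis using uv by auto
        next
          case 4 then show ?thesis using disj uv by (auto simp: h'_def)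
        qed
      qed
      have X: "X \<in> nsets M0 r" using cX \<open>V \<subseteq> M\<close> MT T' by (auto simp: nsets_def X_def)
      have "h' ` X \<subseteq> M0" using hM MT T' by (auto simp: h'_def X_def)
      moreover have "card (h' ` X) = r"
        using sm cX by (simp add: card_image strict_mono_on_imp_inj_on)
      ultimately have X': "h' ` X \<in> nsets M0 r" using cX by (auto simp: nsets_def)
      have bij: "bij_betw (e X) {..<r} X"
        using bij_betw_nth[of "sorted_list_of_set X" "{..<r}" X] cX
        by (auto simp: e_def[abs_def])
      \<comment> \<open>\<open>S\<close> is the pattern of positions of \<open>F\<close> in
        \<open>X\<close>. Read in the image of \<open>X\<close> under \<open>h'\<close>, the same
        pattern gives the image of \<open>F\<close> under \<open>h\<close>, so the two residues are
        the same entry of equal tables.\<close>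
      define S where "S = (\<lambda>p. {i. i < r \<and> e X i \<in> p}) ` F"
      have eS: "e X ` {i. i < r \<and> e X i \<in> p} = p" if "p \<in> F" for p
      proof -
        have "p \<subseteq> X" using that by (auto simp: X_def V_def)
        then show ?thesis using bij by (auto simp: bij_betw_def)
      qed
      have S: "S \<in> Pow (Pow {..<r})" by (auto simp: S_def)
      have SF: "(`) (e X) ` S = F"
        unfolding S_def image_image using eS by simp
      have e': "e (h' ` X) i = h' (e X i)" if "i < r" for i
        using sm cX that by (simp add: e_def sorted_list_of_set_strict_mono_image)
      have "(`) (e (h' ` X)) ` S = (`) (\<lambda>i. h' (e X i)) ` S"
        by (rule image_image_cong_on) (use S e' in auto)
      also have "\<dots> = (`) h' ` ((`) (e X) ` S)"
        by (simp add: image_image)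
      also have "\<dots> = (`) h ` F"
        unfolding SF by (rule image_image_cong_on) (auto simp: h'_def V_def)
      finally have "coef ((`) h ` F) mod q = f (h' ` X) S"
        using S by (simp add: f_def)
      also have "\<dots> = f X S" using col[OF X] col[OF X'] by simp
      also have "\<dots> = coef F mod q" using S SF by (simp add: f_def)
      finally show ?thesis .
    qed
    moreover have "M \<subseteq> B" using MT M0 by auto
    ultimately show "\<exists>M\<subseteq>B. card M = L \<and>
         (\<forall>F h. F \<subseteq> Pow M \<longrightarrow> card (\<Union>F) \<le> r \<longrightarrow> strict_mono_on (\<Union>F) h \<longrightarrow> h ` \<Union>F \<subseteq> M
            \<longrightarrow> coef ((`) h ` F) mod q = coef F mod q)"
      using card by blast
  qed
qed

section \<open>Divisibility of sums graded by cardinality\<close>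

text \<open>With \<open>n = a * fact r\<close>, the absorption identity reads
  \<open>j * (n choose j) = n * ((n - 1) choose (j - 1))\<close>. As \<open>j\<close> divides
  \<open>fact r\<close>, it can be cancelled while the factor \<open>a\<close> survives.\<close>

lemma dvd_binomial_mult_fact:
  assumes "1 \<le> j" "j \<le> r"
  shows "a dvd (a * fact r) choose j"
proof -
  obtain t :: nat where t: "fact r = j * t"
    using assms dvd_fact[of j r] by (auto elim: dvdE)
  have "j * ((a * fact r) choose j) = a * fact r * ((a * fact r - 1) choose (j - 1))"
    using assms times_binomial_minus1_eq[of j "a * fact r"] by simp
  also have "\<dots> = j * (a * (t * ((a * fact r - 1) choose (j - 1))))"
    by (subst t) (simp only: mult_ac)
  finally have "(a * fact r) choose j = a * (t * ((a * fact r - 1) choose (j - 1)))"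
    using assms by simp
  then show ?thesis by simp
qed

text \<open>Grouping by cardinality, the sets of size \<open>j\<close> contribute
  \<open>card I choose j\<close> times a common residue. This is 0 modulo \<open>q\<close> for
  \<open>1 \<le> j \<le> r\<close>, while the empty set and the sets larger than \<open>r\<close>
  contribute 0 by assumption.\<close>

lemma sum_Pow_cong_0:
  fixes g :: "'a set \<Rightarrow> int" and q :: int
  assumes "finite I"
    and eq: "\<And>Y Y'. \<lbrakk>Y \<subseteq> I; Y' \<subseteq> I; card Y = card Y'\<rbrakk> \<Longrightarrow> g Y mod q = g Y' mod q"
    and 0: "g {} = 0"
    and large: "\<And>Y. \<lbrakk>Y \<subseteq> I; r < card Y\<rbrakk> \<Longrightarrow> g Y = 0"
    and dvd: "\<And>j. \<lbrakk>1 \<le> j; j \<le> r\<rbrakk> \<Longrightarrow> q dvd int (card I choose j)"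
  shows "q dvd (\<Sum>Y\<in>Pow I. g Y)"
proof -
  have "(\<Sum>Y\<in>Pow I. g Y) = (\<Sum>j\<in>{..card I}. \<Sum>Y\<in>{Y\<in>Pow I. card Y = j}. g Y)"
    by (rule sum.group[symmetric]) (use assms in \<open>auto intro: card_mono\<close>)
  moreover have "q dvd (\<Sum>Y\<in>{Y\<in>Pow I. card Y = j}. g Y)" if j: "j \<le> card I" for j
  proof -
    obtain Y0 where Y0: "Y0 \<subseteq> I" "card Y0 = j"
      using obtain_subset_with_card_n[OF j] by metis
    consider "j = 0" | "1 \<le> j" "j \<le> r" | "r < j" by linarith
    then show ?thesis
    proof cases
      case 1
      then have "{Y\<in>Pow I. card Y = j} = {{}}"
        using assms(1) by (auto dest: finite_subset)
      then show ?thesis using 0 by simp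
    next
      case 2
      have "(\<Sum>Y\<in>{Y\<in>Pow I. card Y = j}. g Y) mod q
          = (\<Sum>Y\<in>{Y\<in>Pow I. card Y = j}. g Y mod q) mod q"
        by (rule mod_sum_eq[symmetric])
      also have "\<dots> = (\<Sum>Y\<in>{Y\<in>Pow I. card Y = j}. g Y0 mod q) mod q"
        by (intro arg_cong[where f = "\<lambda>x. x mod q"] sum.cong refl eq) (use Y0 in auto)
      also have "\<dots> = (int (card I choose j) * (g Y0 mod q)) mod q"
        using n_subsets[OF assms(1)] by (simp add: Pow_def)
      also have "\<dots> = 0" using dvd[OF 2] by auto
      finally show ?thesis by auto
    next
      case 3
      then show ?thesis using large by (intro dvd_sum) auto
    qed
  qed
  ultimately show ?thesis by (auto intro: dvd_sum)
qed

section \<open>Block maps and restriction of polynomials\<close>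

text \<open>
  Wildcard sets are encoded by a single function: \<open>\<pi> v = i\<close> if \<open>v \<in> I\<^sub>i\<close> and \<open>\<pi> v = 0\<close> if \<open>v\<close> lies
  in none of them. The \<open>q\<close> with \<open>b\<^sub>q(p) = 1\<close> is then \<open>\<pi> ` p\<close>. The values of \<open>c\<close> on pairs inside
  the wildcards are ignored by \<open>emb\<close>, so any point of the subspace may serve as \<open>c\<close>.
\<close>

definition block_map :: "nat \<Rightarrow> nat \<Rightarrow> (nat \<Rightarrow> nat) \<Rightarrow> bool" where
  "block_map n m \<pi> \<longleftrightarrow> \<pi> 0 = 0 \<and> \<pi> ` {1..n} \<subseteq> {..m} \<and> {1..m} \<subseteq> \<pi> ` {1..n} \<and>
     (\<forall>u\<in>{1..n}. \<forall>v\<in>{1..n}. u < v \<longrightarrow> 0 < \<pi> u \<longrightarrow> 0 < \<pi> v \<longrightarrow> \<pi> u \<le> \<pi> v)"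

definition emb :: "nat \<Rightarrow> (nat \<Rightarrow> nat) \<Rightarrow> (nat set \<Rightarrow> bool) \<Rightarrow> (nat set \<Rightarrow> bool) \<Rightarrow> nat set \<Rightarrow> bool" where
  "emb n \<pi> c y p = (if p \<in> pairs n \<and> 0 \<notin> \<pi> ` p then y (\<pi> ` p) else c p)"

lemma finite_pairs [simp]: "finite (pairs n)"
  by (rule finite_subset[of _ "Pow {1..n}"]) (auto simp: pairs_def)

lemma finite_pairs_mem: "p \<in> pairs n \<Longrightarrow> finite p"
  unfolding pairs_def using finite_subset[of p "{1..n}"] by simp

lemma bij_betw_cube: "bij_betw (\<lambda>x. {p. x p}) (cube n) (Pow (pairs n))"
  by (rule bij_betw_byWitness[where f' = "\<lambda>A p. p \<in> A"]) (auto simp: cube_def)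

lemma finite_cube [simp]: "finite (cube n)"
  using bij_betw_cube[of n] bij_betw_finite by fastforce

lemma card_cube: "card (cube n) = 2 ^ card (pairs n)"
  using bij_betw_same_card[OF bij_betw_cube] by (simp add: card_Pow)

lemma image_block_map_pairs:
  assumes "block_map n m \<pi>" "p \<in> pairs n" "0 \<notin> \<pi> ` p"
  shows "\<pi> ` p \<in> pairs m"
proof -
  have "\<pi> v \<in> {1..m}" if "v \<in> p" for v
  proof -
    have "v \<in> {1..n}" using assms(2) that by (auto simp: pairs_def)
    then have "\<pi> v \<le> m" using assms(1) by (simp add: block_map_def image_subset_iff)
    moreover have "\<pi> v \<noteq> 0" using assms(3) that by (metis imageI)
    ultimately show ?thesis by simp
  qed
  then have "\<pi> ` p \<subseteq> {1..m}" by auto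
  moreover have "card (\<pi> ` p) \<le> 2"
    using card_image_le[OF finite_pairs_mem[OF assms(2)], of \<pi>] assms(2) by (simp add: pairs_def)
  ultimately show ?thesis using assms(2) by (auto simp: pairs_def)
qed

lemma block_map_pairs_surj:
  assumes "block_map n m \<pi>" "q \<in> pairs m"
  obtains p where "p \<in> pairs n" "\<pi> ` p = q" "0 \<notin> \<pi> ` p"
proof -
  have "q \<subseteq> \<pi> ` {1..n}" using assms by (auto simp: block_map_def pairs_def)
  \<comment> \<open>One preimage is chosen for each element of \<open>q\<close>, so \<open>p\<close>
    has as many elements as \<open>q\<close> and is again a member of
    \<open>pairs n\<close>.\<close>
  then obtain p where p: "p \<subseteq> {1..n}" "inj_on \<pi> p" "q = \<pi> ` p"
    by (auto simp: subset_image_inj)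
  have "p \<in> pairs n" using p assms(2) by (auto simp: pairs_def card_image)
  moreover have "0 \<notin> q" using assms(2) by (auto simp: pairs_def)
  ultimately show thesis using that p by auto
qed

lemma emb_in_cube: "c \<in> cube n \<Longrightarrow> emb n \<pi> c y \<in> cube n"
  by (auto simp: cube_def emb_def)

lemma inj_on_emb:
  assumes "block_map n m \<pi>"
  shows "inj_on (emb n \<pi> c) (cube m)"
proof (rule inj_onI, rule ext)
  fix y z q assume yz: "y \<in> cube m" "z \<in> cube m" "emb n \<pi> c y = emb n \<pi> c z"
  show "y q = z q"
  proof (cases "q \<in> pairs m")
    case True
    with assms obtain p where "p \<in> pairs n" "\<pi> ` p = q" "0 \<notin> \<pi> ` p"
      by (rule block_map_pairs_surj)
    with fun_cong[OF yz(3), of p] show ?thesis by (auto simp: emb_def)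
  qed (use yz in \<open>auto simp: cube_def\<close>)
qed

lemma block_map_comp:
  assumes "block_map n m' \<pi>" "block_map m' m \<rho>"
  shows "block_map n m (\<rho> \<circ> \<pi>)"
proof -
  have \<pi>: "\<pi> 0 = 0" "\<And>v. v \<in> {1..n} \<Longrightarrow> \<pi> v \<le> m'" "{1..m'} \<subseteq> \<pi> ` {1..n}"
    "\<And>u v. \<lbrakk>u \<in> {1..n}; v \<in> {1..n}; u < v; 0 < \<pi> u; 0 < \<pi> v\<rbrakk> \<Longrightarrow> \<pi> u \<le> \<pi> v"
    using assms(1) by (simp_all add: block_map_def image_subset_iff)
  have \<rho>: "\<rho> 0 = 0" "\<And>v. v \<in> {1..m'} \<Longrightarrow> \<rho> v \<le> m" "{1..m} \<subseteq> \<rho> ` {1..m'}"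
    "\<And>u v. \<lbrakk>u \<in> {1..m'}; v \<in> {1..m'}; u < v; 0 < \<rho> u; 0 < \<rho> v\<rbrakk> \<Longrightarrow> \<rho> u \<le> \<rho> v"
    using assms(2) by (simp_all add: block_map_def image_subset_iff)
  have "\<rho> (\<pi> v) \<le> m" if "v \<in> {1..n}" for v
    using \<pi>(2)[OF that] \<rho>(1) \<rho>(2)[of "\<pi> v"] by (cases "\<pi> v = 0") auto
  moreover have "{1..m} \<subseteq> (\<rho> \<circ> \<pi>) ` {1..n}"
    using image_mono[OF \<pi>(3), of \<rho>] \<rho>(3) by (simp add: image_comp)
  moreover have "\<rho> (\<pi> u) \<le> \<rho> (\<pi> v)"
    if uv: "u \<in> {1..n}" "v \<in> {1..n}" "u < v" "0 < \<rho> (\<pi> u)" "0 < \<rho> (\<pi> v)" for u v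
  proof -
    have pos: "0 < \<pi> u" "0 < \<pi> v" using uv \<rho>(1) by (metis gr0I)+
    then have "\<pi> u \<le> \<pi> v" using \<pi>(4) uv by blast
    moreover have "\<pi> u \<in> {1..m'}" "\<pi> v \<in> {1..m'}" using pos \<pi>(2) uv by auto
    ultimately show ?thesis using \<rho>(4) uv by (cases "\<pi> u = \<pi> v") auto
  qed
  ultimately show ?thesis using \<pi>(1) \<rho>(1) by (simp add: block_map_def image_subset_iff)
qed

text \<open>Subspaces of subspaces are subspaces. A vertex that \<open>\<pi>\<close> sends to 0
  stays at 0 because \<open>\<rho> 0 = 0\<close>, so its coordinates are read from \<open>c\<close>.
  A coordinate fixed only by \<open>\<rho>\<close> is read from \<open>c'\<close> through
  \<open>\<pi>\<close>. Both cases are recorded by the base point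
  \<open>emb n \<pi> c c'\<close>.\<close>

lemma emb_emb:
  assumes "block_map n m' \<pi>" "\<rho> 0 = 0"
  shows "emb n \<pi> c (emb m' \<rho> c' y) = emb n (\<rho> \<circ> \<pi>) (emb n \<pi> c c') y"
proof
  fix p
  have comp: "(\<rho> \<circ> \<pi>) ` p = \<rho> ` \<pi> ` p" by (simp add: image_comp)
  have "0 \<in> \<rho> ` \<pi> ` p" if "0 \<in> \<pi> ` p"
    using imageI[OF that, of \<rho>] assms(2) by simp
  moreover have "\<pi> ` p \<in> pairs m'" if "p \<in> pairs n" "0 \<notin> \<pi> ` p"
    using image_block_map_pairs[OF assms(1) that] .
  ultimately show "emb n \<pi> c (emb m' \<rho> c' y) p = emb n (\<rho> \<circ> \<pi>) (emb n \<pi> c c') y p"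
    unfolding emb_def comp by presburger
qed

text \<open>Bridge to the official definition: the wildcard sets are the fibres of
  \<open>\<pi>\<close> over \<open>{1..m}\<close>, and the monotonicity of \<open>\<pi>\<close> on
  its support is the block condition.\<close>

lemma block_hj_subspace_emb:
  assumes \<pi>: "block_map n m \<pi>" and "1 \<le> m" and c: "c \<in> cube n"
  shows "block_hj_subspace n m (emb n \<pi> c ` cube m)"
proof -
  define I where "I i = {v \<in> {1..n}. \<pi> v = i}" for i
  \<comment> \<open>The fixed part of an HJ-embedding must vanish on pairs inside the wildcard sets,
    whereas \<open>emb\<close> ignores the values of \<open>c\<close> there; hence they are
    cleared.\<close>
  define c0 where "c0 p = (c p \<and> 0 \<in> \<pi> ` p)" for p
  have ne: "I i \<noteq> {}" if "i \<in> {1..m}" for i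
  proof -
    have "i \<in> \<pi> ` {1..n}" using \<pi> that unfolding block_map_def by blast
    then show ?thesis unfolding I_def by blast
  qed
  have fin: "finite (I i)" for i by (auto simp: I_def)
  have less: "a < b" if "a \<in> I i" "b \<in> I j" "i < j" "0 < i" for a b i j
  proof (rule ccontr)
    assume "\<not> a < b"
    moreover have ab: "a \<in> {1..n}" "b \<in> {1..n}" "\<pi> a = i" "\<pi> b = j"
      using that by (simp_all add: I_def)
    ultimately have "b < a" using \<open>i < j\<close> by (cases "a = b") auto
    moreover have "0 < \<pi> a" "0 < \<pi> b" using ab that by simp_all
    ultimately have "\<pi> b \<le> \<pi> a" using \<pi> ab unfolding block_map_def by blast
    then show False using ab that by simp
  qed
  have "wildcards n m I"
    unfolding wildcards_def
  proof (intro conjI ballI impI)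
    fix i j assume ij: "i \<in> {1..m}" "j \<in> {1..m}" "i < j"
    show "Min (I i) < Min (I j)"
      using less[of "Min (I i)" i "Min (I j)" j] Min_in[OF fin ne] ij by auto
  qed (use ne in \<open>auto simp: I_def\<close>)
  moreover have "block_wildcards m I"
    unfolding block_wildcards_def
  proof
    fix i assume i: "i \<in> {1..<m}"
    then have "I i \<noteq> {}" "I (Suc i) \<noteq> {}" using ne[of i] ne[of "Suc i"] by auto
    then show "Max (I i) < Min (I (Suc i))"
      using less[of "Max (I i)" i "Min (I (Suc i))" "Suc i"] Min_in[OF fin] Max_in[OF fin] i by auto
  qed
  moreover have "c0 \<in> cube n" using c by (auto simp: c0_def cube_def)
  moreover have "\<forall>p\<in>pairs n. p \<subseteq> (\<Union>i\<in>{1..m}. I i) \<longrightarrow> \<not> c0 p"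
  proof (intro ballI impI)
    fix p assume "p \<in> pairs n" "p \<subseteq> (\<Union>i\<in>{1..m}. I i)"
    then have "0 \<notin> \<pi> ` p" by (fastforce simp: I_def)
    then show "\<not> c0 p" by (simp add: c0_def)
  qed
  moreover have "hj_emb m I c0 y = emb n \<pi> c y" for y
  proof
    fix p
    \<comment> \<open>At most one \<open>q\<close> contributes to a given \<open>p\<close>, so the
      parity in \<open>Id_emb\<close> amounts to the single bit \<open>y q\<close>.\<close>
    have bvec: "bvec I q p \<longleftrightarrow> p \<in> pairs n \<and> \<pi> ` p = q" if q: "q \<in> pairs m" for q
    proof
      assume b: "bvec I q p"
      then have "p \<subseteq> {1..n}" by (auto simp: bvec_def I_def)
      moreover have "\<pi> ` p \<subseteq> q" using b by (auto simp: bvec_def I_def)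
      moreover have "q \<subseteq> \<pi> ` p" using b by (force simp: bvec_def I_def)
      ultimately show "p \<in> pairs n \<and> \<pi> ` p = q" using b by (auto simp: bvec_def pairs_def)
    next
      assume "p \<in> pairs n \<and> \<pi> ` p = q"
      moreover from this have "v \<in> I (\<pi> v)" if "v \<in> p" for v
        using that by (auto simp: I_def pairs_def)
      ultimately show "bvec I q p" unfolding bvec_def pairs_def by blast
    qed
    have "{q \<in> pairs m. y q \<and> bvec I q p}
      = (if p \<in> pairs n \<and> 0 \<notin> \<pi> ` p \<and> y (\<pi> ` p) then {\<pi> ` p} else {})"
    proof -
      have "{q \<in> pairs m. y q \<and> bvec I q p} = {q \<in> pairs m. y q \<and> p \<in> pairs n \<and> \<pi> ` p = q}"
        using bvec by blast
      moreover have "0 \<notin> q" if "q \<in> pairs m" for q using that by (auto simp: pairs_def)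
      ultimately show ?thesis using image_block_map_pairs[OF \<pi>, of p] by auto
    qed
    then have "Id_emb m I y p \<longleftrightarrow> p \<in> pairs n \<and> 0 \<notin> \<pi> ` p \<and> y (\<pi> ` p)"
      by (simp add: Id_emb_def)
    then show "hj_emb m I c0 y p = emb n \<pi> c y p"
      using c by (auto simp: hj_emb_def emb_def c0_def cube_def)
  qed
  then have "emb n \<pi> c ` cube m = hj_emb m I c0 ` cube m" by simp
  moreover have "m \<le> n"
  proof -
    have "card {1..m} \<le> card (\<pi> ` {1..n})"
      using \<pi> by (intro card_mono) (auto simp: block_map_def)
    also have "\<dots> \<le> card {1..n}" by (rule card_image_le) simp
    finally show ?thesis by simp
  qed
  ultimately show ?thesis using assms(2) unfolding block_hj_subspace_def by blast
qed

section \<open>Multilinear polynomials on the cube and their restriction\<close>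

text \<open>The empty monomial is included and carries the constant term. Values are plain integers,
  so that reduction modulo \<open>q\<close> is left to the statements and restrictions can be
  computed exactly.\<close>

definition multilinear :: "nat \<Rightarrow> nat \<Rightarrow> (nat set set \<Rightarrow> int) \<Rightarrow> (nat set \<Rightarrow> bool) \<Rightarrow> int" where
  "multilinear n D coef x = (\<Sum>F | F \<subseteq> pairs n \<and> card F \<le> D. coef F * of_bool (\<forall>e\<in>F. x e))"

lemma finite_subset_pairs [simp]: "finite {F. F \<subseteq> pairs n \<and> P F}"
  by (rule finite_subset[of _ "Pow (pairs n)"]) auto

text \<open>Restriction turns the variables outside the wildcards into constants and may merge
  others, so the degree cannot grow. A monomial \<open>F'\<close> of degree \<open>Suc D\<close>
  arises only from monomials of the same degree in which nothing is fixed and nothing merges. Its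
  coefficient is therefore the sum in the hypothesis, whatever \<open>c\<close> is, and it vanishes
  modulo \<open>q\<close>.\<close>

lemma multilinear_emb:
  assumes \<pi>: "block_map n m \<pi>"
    and dvd: "\<And>F'. \<lbrakk>F' \<subseteq> pairs m; card F' = Suc D\<rbrakk> \<Longrightarrow>
       q dvd (\<Sum>F | F \<subseteq> pairs n \<and> card F = Suc D \<and> (`) \<pi> ` F = F'. coef F)"
  shows "\<exists>coef'. \<forall>y. multilinear n (Suc D) coef (emb n \<pi> c y) mod q = multilinear m D coef' y mod q"
proof -
  \<comment> \<open>\<open>red F\<close> is the monomial left of \<open>F\<close> after restriction,
    and the family defined next consists of the monomials that \<open>c\<close> does not
    annihilate.\<close>
  define red where "red F = (`) \<pi> ` {p \<in> F. 0 \<notin> \<pi> ` p}" for F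
  define \<F> where "\<F> = {F. F \<subseteq> pairs n \<and> card F \<le> Suc D \<and> (\<forall>e\<in>F. 0 \<in> \<pi> ` e \<longrightarrow> c e)}"
  define coef' where "coef' F' = (\<Sum>F | F \<in> \<F> \<and> red F = F'. coef F)" for F'
  have finF: "finite F" if "F \<subseteq> pairs n" for F
    using that finite_pairs finite_subset by blast
  have fin: "finite \<F>" by (simp add: \<F>_def)
  have card_red: "card (red F) \<le> card F" if "F \<subseteq> pairs n" for F
  proof -
    have "card (red F) \<le> card {p \<in> F. 0 \<notin> \<pi> ` p}"
      unfolding red_def using finF[OF that] by (intro card_image_le) auto
    also have "\<dots> \<le> card F" using finF[OF that] by (intro card_mono) auto
    finally show ?thesis .
  qed
  have red: "red ` \<F> \<subseteq> {F'. F' \<subseteq> pairs m \<and> card F' \<le> Suc D}"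
  proof (clarsimp, intro conjI)
    fix F assume F: "F \<in> \<F>"
    then show "red F \<subseteq> pairs m"
      using image_block_map_pairs[OF \<pi>] by (auto simp: red_def \<F>_def)
    show "card (red F) \<le> Suc D" using F card_red[of F] by (auto simp: \<F>_def)
  qed
  have top: "q dvd coef' F'" if F': "F' \<subseteq> pairs m" "card F' = Suc D" for F'
  proof -
    have no0: "0 \<notin> p" if "p \<in> F'" for p using that F' by (force simp: pairs_def)
    have "F \<in> \<F> \<and> red F = F' \<longleftrightarrow> F \<subseteq> pairs n \<and> card F = Suc D \<and> (`) \<pi> ` F = F'" for F
    proof
      assume F: "F \<in> \<F> \<and> red F = F'"
      then have "F \<subseteq> pairs n" "card F \<le> Suc D" by (auto simp: \<F>_def)
      \<comment> \<open>Equality of degrees is forced here: \<open>F'\<close> already has the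
        maximal size \<open>Suc D\<close>, so every factor of \<open>F\<close> is free.\<close>
      moreover have "card F' \<le> card {p \<in> F. 0 \<notin> \<pi> ` p}"
        using F finF[OF \<open>F \<subseteq> pairs n\<close>] unfolding red_def by (auto intro: card_image_le)
      ultimately have "card F \<le> card {p \<in> F. 0 \<notin> \<pi> ` p}" using F' by simp
      then have "{p \<in> F. 0 \<notin> \<pi> ` p} = F"
        using finF[OF \<open>F \<subseteq> pairs n\<close>] by (intro card_seteq) auto
      then show "F \<subseteq> pairs n \<and> card F = Suc D \<and> (`) \<pi> ` F = F'"
        using F F' card_red[of F] by (auto simp: red_def \<F>_def)
    next
      assume F: "F \<subseteq> pairs n \<and> card F = Suc D \<and> (`) \<pi> ` F = F'"
      then have "\<forall>p\<in>F. 0 \<notin> \<pi> ` p" using no0 by blast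
      then have "{p \<in> F. 0 \<notin> \<pi> ` p} = F" by auto
      then show "F \<in> \<F> \<and> red F = F'"
        using F \<open>\<forall>p\<in>F. 0 \<notin> \<pi> ` p\<close> unfolding red_def \<F>_def by auto
    qed
    then show ?thesis using dvd[OF F'] by (simp add: coef'_def)
  qed
  have "multilinear n (Suc D) coef (emb n \<pi> c y) mod q = multilinear m D coef' y mod q" for y
  proof -
    have eval: "(\<forall>e\<in>F. emb n \<pi> c y e) \<longleftrightarrow> (\<forall>e\<in>F. 0 \<in> \<pi> ` e \<longrightarrow> c e) \<and> (\<forall>e\<in>red F. y e)"
      if "F \<subseteq> pairs n" for F
      using that by (fastforce simp: emb_def red_def)
    have "multilinear n (Suc D) coef (emb n \<pi> c y)
       = (\<Sum>F | F \<subseteq> pairs n \<and> card F \<le> Suc D.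
           coef F * of_bool ((\<forall>e\<in>F. 0 \<in> \<pi> ` e \<longrightarrow> c e) \<and> (\<forall>e\<in>red F. y e)))"
      unfolding multilinear_def by (rule sum.cong) (use eval in auto)
    also have "\<dots> = (\<Sum>F\<in>\<F>. coef F * of_bool (\<forall>e\<in>red F. y e))"
      by (rule sum.mono_neutral_cong_right) (auto simp: \<F>_def)
    also have "\<dots> = (\<Sum>F' | F' \<subseteq> pairs m \<and> card F' \<le> Suc D.
        \<Sum>F | F \<in> \<F> \<and> red F = F'. coef F * of_bool (\<forall>e\<in>red F. y e))"
      by (rule sum.group[symmetric]) (use fin red in auto)
    also have "\<dots> = (\<Sum>F' | F' \<subseteq> pairs m \<and> card F' \<le> Suc D. coef' F' * of_bool (\<forall>e\<in>F'. y e))"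
      unfolding coef'_def sum_distrib_right by (intro sum.cong refl) auto
    also have "{F'. F' \<subseteq> pairs m \<and> card F' \<le> Suc D}
       = {F'. F' \<subseteq> pairs m \<and> card F' \<le> D} \<union> {F'. F' \<subseteq> pairs m \<and> card F' = Suc D}"
      by auto
    also have "(\<Sum>F'\<in>\<dots>. coef' F' * of_bool (\<forall>e\<in>F'. y e))
       = multilinear m D coef' y + (\<Sum>F' | F' \<subseteq> pairs m \<and> card F' = Suc D. coef' F' * of_bool (\<forall>e\<in>F'. y e))"
      unfolding multilinear_def by (rule sum.union_disjoint) auto
    finally have "multilinear n (Suc D) coef (emb n \<pi> c y) = \<dots>" .
    moreover have "q dvd (\<Sum>F' | F' \<subseteq> pairs m \<and> card F' = Suc D. coef' F' * of_bool (\<forall>e\<in>F'. y e))"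
      using top by (intro dvd_sum) (auto intro: dvd_mult2)
    ultimately show ?thesis by (auto elim!: dvdE)
  qed
  then show ?thesis by blast
qed

section \<open>Cancellation of the top degree\<close>

text \<open>The increasing enumeration of one set is composed with the inverse of that of the other.
  Both directions are provided because they serve as mutually inverse reindexings of a sum.\<close>

lemma ex_order_iso:
  fixes Y Y' :: "nat set"
  assumes "finite Y" "finite Y'" "card Y = card Y'"
  obtains a b where "strict_mono_on Y a" "a ` Y = Y'" "strict_mono_on Y' b" "b ` Y' = Y"
    "\<And>v. v \<in> Y \<Longrightarrow> b (a v) = v" "\<And>v. v \<in> Y' \<Longrightarrow> a (b v) = v"
proof -
  obtain g where g: "bij_betw g {..<card Y} Y" "strict_mono_on {..<card Y} g"
    using ex_bij_betw_strict_mono_card assms(1) by metis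
  obtain h where h: "bij_betw h {..<card Y} Y'" "strict_mono_on {..<card Y} h"
    using ex_bij_betw_strict_mono_card assms(2) assms(3) by metis
  have comp: "strict_mono_on A (k \<circ> inv_into C f) \<and> (k \<circ> inv_into C f) ` A = B"
    if "bij_betw f C A" "strict_mono_on C f" "bij_betw k C B" "strict_mono_on C k"
    for f k :: "nat \<Rightarrow> nat" and A B C
  proof -
    have "inv_into C f u < inv_into C f v" if "u \<in> A" "v \<in> A" "u < v" for u v
    proof -
      have C: "inv_into C f u \<in> C" "inv_into C f v \<in> C" "f (inv_into C f u) = u" "f (inv_into C f v) = v"
        using that \<open>bij_betw f C A\<close> by (auto simp: bij_betw_def inv_into_into f_inv_into_f)
      have "\<not> inv_into C f v < inv_into C f u"
        using \<open>strict_mono_on C f\<close> C that by (metis less_asym strict_mono_onD)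
      moreover have "inv_into C f v \<noteq> inv_into C f u" using C that by auto
      ultimately show ?thesis by simp
    qed
    moreover have "inv_into C f ` A = C"
      using \<open>bij_betw f C A\<close> by (metis bij_betw_def bij_betw_inv_into)
    moreover from this have "inv_into C f v \<in> C" if "v \<in> A" for v using that by blast
    ultimately have "strict_mono_on A (k \<circ> inv_into C f)"
      using \<open>strict_mono_on C k\<close> unfolding strict_mono_on_def comp_def by blast
    moreover have "(k \<circ> inv_into C f) ` A = B"
      using \<open>inv_into C f ` A = C\<close> \<open>bij_betw k C B\<close> by (metis bij_betw_imp_surj_on image_comp)
    ultimately show ?thesis ..
  qed
  show thesis
  proof (rule that[of "h \<circ> inv_into {..<card Y} g" "g \<circ> inv_into {..<card Y} h"])
    show "(g \<circ> inv_into {..<card Y} h) ((h \<circ> inv_into {..<card Y} g) v) = v" if "v \<in> Y" for v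
    proof -
      have "inv_into {..<card Y} g v \<in> {..<card Y}"
        using that g(1) by (metis bij_betw_def inv_into_into)
      then show ?thesis
        using that by (simp add: bij_betw_inv_into_left[OF h(1)] bij_betw_inv_into_right[OF g(1)])
    qed
    show "(h \<circ> inv_into {..<card Y} g) ((g \<circ> inv_into {..<card Y} h) v) = v" if "v \<in> Y'" for v
    proof -
      have "inv_into {..<card Y} h v \<in> {..<card Y}"
        using that h(1) by (metis bij_betw_def inv_into_into)
      then show ?thesis
        using that by (simp add: bij_betw_inv_into_left[OF g(1)] bij_betw_inv_into_right[OF h(1)])
    qed
  qed (use comp[OF g h] comp[OF h g] in auto)
qed

lemma ex_equal_blocks:
  fixes M :: "nat set"
  assumes M: "M \<subseteq> {1..n}" "card M = m * s" and "s > 0"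
  obtains \<pi> where "block_map n m \<pi>" "{v. \<pi> v \<noteq> 0} = M" "\<forall>i\<in>{1..m}. card {v. \<pi> v = i} = s"
proof -
  have "finite M" using M finite_subset by blast
  then obtain g where g: "bij_betw g {..<m * s} M" "strict_mono_on {..<m * s} g"
    using ex_bij_betw_strict_mono_card M(2) by metis
  \<comment> \<open>The rank of \<open>v\<close> in \<open>M\<close>, counted from 0, is divided by
    \<open>s\<close>. The added 1 keeps the value 0 for vertices outside the wildcards.\<close>
  define \<pi> where "\<pi> v = (if v \<in> M then inv_into {..<m * s} g v div s + 1 else 0)" for v
  have M_eq: "M = g ` {..<m * s}" using g by (simp add: bij_betw_def)
  have inj: "inj_on g {..<m * s}" using g by (simp add: bij_betw_def)
  have \<pi>g: "\<pi> (g j) = j div s + 1" if "j < m * s" for j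
    using that inj by (simp add: \<pi>_def M_eq)
  have nz: "{v. \<pi> v \<noteq> 0} = M" by (auto simp: \<pi>_def)
  have block: "{v. \<pi> v = i} = g ` {(i - 1) * s..<i * s}" and sub: "{(i - 1) * s..<i * s} \<subseteq> {..<m * s}"
    if i: "i \<in> {1..m}" for i
  proof -
    show sub: "{(i - 1) * s..<i * s} \<subseteq> {..<m * s}"
    proof
      fix j assume "j \<in> {(i - 1) * s..<i * s}"
      then have "j < i * s" by simp
      also have "i * s \<le> m * s" using i by simp
      finally show "j \<in> {..<m * s}" by simp
    qed
    have iff: "j div s + 1 = i \<longleftrightarrow> j \<in> {(i - 1) * s..<i * s}" for j
    proof -
      have "j div s = i - 1 \<longleftrightarrow> (i - 1) * s \<le> j \<and> j < Suc (i - 1) * s"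
        using \<open>s > 0\<close> by (metis div_nat_eqI dividend_less_div_times mult.commute mult_Suc times_div_less_eq_dividend)
      moreover have "Suc (i - 1) = i" using i by simp
      ultimately show ?thesis by auto
    qed
    have "{v. \<pi> v = i} = {v \<in> M. \<pi> v = i}" using i nz by auto
    also have "\<dots> = g ` {j \<in> {..<m * s}. j div s + 1 = i}"
      unfolding M_eq using \<pi>g by auto
    also have "{j \<in> {..<m * s}. j div s + 1 = i} = {(i - 1) * s..<i * s}"
      using iff sub by blast
    finally show "{v. \<pi> v = i} = g ` {(i - 1) * s..<i * s}" .
  qed
  have card: "card {v. \<pi> v = i} = s" if "i \<in> {1..m}" for i
  proof -
    have "card {v. \<pi> v = i} = card {(i - 1) * s..<i * s}"
      unfolding block[OF that] using inj sub[OF that] by (intro card_image inj_on_subset[OF inj])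
    also have "\<dots> = s" using that by (simp add: algebra_simps diff_mult_distrib)
    finally show ?thesis .
  qed
  show thesis
  proof (rule that)
    show "{v. \<pi> v \<noteq> 0} = M" by fact
    show "\<forall>i\<in>{1..m}. card {v. \<pi> v = i} = s" using card ..
    have "\<pi> v \<le> m" for v
    proof (cases "v \<in> M")
      case True
      then obtain j where "j < m * s" "v = g j" by (auto simp: M_eq)
      then show ?thesis using \<pi>g[of j] \<open>s > 0\<close> by (simp add: less_mult_imp_div_less Suc_le_eq)
    qed (simp add: \<pi>_def)
    moreover have "i \<in> \<pi> ` {1..n}" if "i \<in> {1..m}" for i
    proof -
      have "{v. \<pi> v = i} \<noteq> {}" using card[OF that] \<open>s > 0\<close> by (metis card.empty less_irrefl)
      then obtain v where "\<pi> v = i" by auto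
      moreover from this that have "v \<in> M" using nz by auto
      ultimately show ?thesis using M by auto
    qed
    moreover have "\<pi> u \<le> \<pi> v" if "u < v" "0 < \<pi> u" "0 < \<pi> v" for u v
    proof -
      have "u \<in> M" "v \<in> M" using that nz by auto
      then obtain a b where ab: "a < m * s" "u = g a" "b < m * s" "v = g b" by (auto simp: M_eq)
      have "\<not> b \<le> a"
      proof
        assume "b \<le> a"
        then have "g b \<le> g a" using g(2) ab by (cases "a = b") (auto simp: strict_mono_on_def less_imp_le)
        then show False using ab that by simp
      qed
      then show ?thesis using ab \<pi>g by (simp add: div_le_mono)
    qed
    moreover have "\<pi> 0 = 0" using M by (auto simp: \<pi>_def)
    ultimately show "block_map n m \<pi>" unfolding block_map_def by auto
  qed
qed

text \<open>A single block met by \<open>F'\<close> already gives the cancellation. The bound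
  \<open>2 * t\<close> appears because \<open>t\<close> sets of at most two vertices span at most
  \<open>2 * t\<close> vertices: homogeneity then applies to every monomial involved, and no trace
  on the block is larger.\<close>

lemma top_coefficients_dvd:
  fixes coef :: "nat set set \<Rightarrow> int" and q :: int
  assumes M: "M \<subseteq> {1..n}"
    and hom: "\<And>F h. \<lbrakk>F \<subseteq> Pow M; card (\<Union>F) \<le> 2 * t; strict_mono_on (\<Union>F) h; h ` \<Union>F \<subseteq> M\<rbrakk>
        \<Longrightarrow> coef ((`) h ` F) mod q = coef F mod q"
    and \<pi>: "block_map n m \<pi>" "{v. \<pi> v \<noteq> 0} = M"
    and s: "\<forall>i\<in>{1..m}. card {v. \<pi> v = i} = s"
    and dvd: "\<And>j. \<lbrakk>1 \<le> j; j \<le> 2 * t\<rbrakk> \<Longrightarrow> q dvd int (s choose j)"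
    and F': "F' \<subseteq> pairs m" "F' \<noteq> {}"
  shows "q dvd (\<Sum>F | F \<subseteq> pairs n \<and> card F = t \<and> (`) \<pi> ` F = F'. coef F)"
proof -
  obtain p' i where p': "p' \<in> F'" "i \<in> p'" "i \<in> {1..m}"
    using F' by (fastforce simp: pairs_def)
  define I where "I = {v. \<pi> v = i}"
  define \<F> where "\<F> = {F. F \<subseteq> pairs n \<and> card F = t \<and> (`) \<pi> ` F = F'}"
  define cls where "cls Z Y = {F \<in> \<F>. \<Union>F - I = Z \<and> \<Union>F \<inter> I = Y}" for Z Y
  have "I \<subseteq> M" using p' \<pi>(2) by (auto simp: I_def)
  have finM: "finite M" using M finite_subset by blast
  then have finI: "finite I" using \<open>I \<subseteq> M\<close> finite_subset by blast
  have fin: "finite \<F>" by (simp add: \<F>_def)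
  have no0: "0 \<notin> p" if "p \<in> F'" for p using that F' by (force simp: pairs_def)
  have mono: "\<pi> u \<le> \<pi> v" if "u < v" "u \<in> M" "v \<in> M" for u v
  proof -
    have "0 < \<pi> u" "0 < \<pi> v" using that \<pi>(2) by auto
    then show ?thesis using that M \<pi>(1) unfolding block_map_def by blast
  qed
  \<comment> \<open>The members of \<open>F'\<close> avoid 0, so a monomial mapped onto
    \<open>F'\<close> uses only vertices of the support \<open>M\<close> of
    \<open>\<pi>\<close>.\<close>
  have sub: "\<Union>F \<subseteq> M" if "F \<in> \<F>" for F
  proof
    fix v assume "v \<in> \<Union>F"
    then obtain p where "p \<in> F" "v \<in> p" by auto
    then have "\<pi> ` p \<in> F'" "\<pi> v \<in> \<pi> ` p" using that by (auto simp: \<F>_def)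
    then show "v \<in> M" using no0 \<pi>(2) by (metis (mono_tags) mem_Collect_eq)
  qed
  have small: "card (\<Union>F) \<le> 2 * t" if "F \<in> \<F>" for F
  proof -
    have "card (\<Union>F) \<le> (\<Sum>p\<in>F. card p)"
      by (rule card_Union_le_sum_card)
    also have "\<dots> \<le> (\<Sum>p\<in>F. 2)"
      using that by (intro sum_mono) (auto simp: \<F>_def pairs_def)
    finally show ?thesis using that by (simp add: \<F>_def)
  qed
  \<comment> \<open>The trace \<open>Y\<close> is moved to \<open>Y'\<close> and all other vertices
    stay. As \<open>Y\<close> and \<open>Y'\<close> lie in the same fibre \<open>I\<close>, the
    value of \<open>\<pi>\<close> at each vertex is unchanged and the image is still
    \<open>F'\<close>.\<close>
  have shift: "(`) (\<lambda>v. if v \<in> Y then h v else v) ` F \<in> cls Z Y'"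
      "coef ((`) (\<lambda>v. if v \<in> Y then h v else v) ` F) mod q = coef F mod q"
    if Y: "Y \<subseteq> I" "Y' \<subseteq> I" and h: "strict_mono_on Y h" "h ` Y = Y'" and F: "F \<in> cls Z Y"
    for Y Y' Z h F
  proof -
    define k where "k v = (if v \<in> Y then h v else v)" for v
    have F\<F>: "F \<in> \<F>" and Z: "\<Union>F - I = Z" "\<Union>F \<inter> I = Y" using F by (auto simp: cls_def)
    have ZM: "Z \<subseteq> M" "Z \<inter> I = {}" "\<Union>F = Z \<union> Y" using sub[OF F\<F>] Z by auto
    have \<pi>k: "\<pi> (k v) = \<pi> v" for v
      using h(2) Y by (auto simp: k_def I_def)
    have kM: "k v \<in> M" if "v \<in> M" for v
      using that h(2) Y \<open>I \<subseteq> M\<close> by (auto simp: k_def)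
    \<comment> \<open>A vertex \<open>u\<close> of \<open>Z\<close> lies in another fibre, and
      \<open>\<pi>\<close> is monotone on \<open>M\<close>. Hence the comparison of \<open>u\<close>
      with any point of \<open>I\<close> is decided by that of \<open>\<pi> u\<close> with
      \<open>i\<close>.\<close>
    have ord: "u < k v \<longleftrightarrow> u < v" "k v < u \<longleftrightarrow> v < u" if "u \<in> Z" "v \<in> Y" for u v
    proof -
      have u: "u \<in> M" "\<pi> u \<noteq> i" "v \<in> M" "\<pi> v = i" "k v \<in> M" "\<pi> (k v) = i"
        using that ZM Y \<open>I \<subseteq> M\<close> kM[of v] \<pi>k by (auto simp: I_def)
      have "u < w \<longleftrightarrow> \<pi> u < i" "w < u \<longleftrightarrow> i < \<pi> u" if "w \<in> M" "\<pi> w = i" for w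
        using mono[of u w] mono[of w u] that u by (metis antisym_conv3 leD le_neq_implies_less)+
      then show "u < k v \<longleftrightarrow> u < v" "k v < u \<longleftrightarrow> v < u" using u by blast+
    qed
    have sm: "strict_mono_on (\<Union>F) k"
    proof (rule strict_mono_onI)
      fix u v assume uv: "u \<in> \<Union>F" "v \<in> \<Union>F" "u < v"
      have kZ: "k w = w" if "w \<in> Z" for w using that ZM Y by (auto simp: k_def)
      show "k u < k v"
        using uv ZM(3) ord[of u v] ord[of v u] kZ h(1) by (auto simp: k_def strict_mono_on_def)
    qed
    have inj: "inj_on k (\<Union>F)" using sm by (rule strict_mono_on_imp_inj_on)
    have kF: "k ` \<Union>F \<subseteq> M" using sub[OF F\<F>] kM by auto
    have "F \<subseteq> Pow M" using sub[OF F\<F>] by auto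
    then have co: "coef ((`) k ` F) mod q = coef F mod q"
      using hom[OF _ small[OF F\<F>] sm kF] by blast
    have "(`) k ` F \<subseteq> pairs n"
    proof (rule image_subsetI)
      fix p assume "p \<in> F"
      then have p: "p \<in> pairs n" using F\<F> by (auto simp: \<F>_def)
      have "k ` p \<subseteq> {1..n}" using kF \<open>p \<in> F\<close> M by blast
      moreover have "card (k ` p) \<le> 2"
        using card_image_le[OF finite_pairs_mem[OF p], of k] p by (simp add: pairs_def)
      ultimately show "k ` p \<in> pairs n" using p by (auto simp: pairs_def)
    qed
    moreover have "card ((`) k ` F) = t"
    proof -
      have "inj_on ((`) k) F"
        using inj_on_image[of k F] inj by simp
      then show ?thesis using F\<F> by (simp add: card_image \<F>_def)
    qed
    moreover have "(`) \<pi> ` (`) k ` F = F'"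
      using F\<F> \<pi>k by (simp add: \<F>_def image_image)
    moreover have "\<Union>((`) k ` F) = Z \<union> Y'"
    proof -
      have "\<Union>((`) k ` F) = k ` \<Union>F" by auto
      also have "\<dots> = k ` Z \<union> k ` Y" by (simp add: ZM(3) image_Un)
      also have "k ` Z = Z" using ZM Y by (auto simp: k_def)
      also have "k ` Y = Y'" using h(2) by (auto simp: k_def)
      finally show ?thesis .
    qed
    ultimately have "(`) k ` F \<in> cls Z Y'"
      using ZM(2) Y(2) by (auto simp: cls_def \<F>_def)
    with co show "(`) (\<lambda>v. if v \<in> Y then h v else v) ` F \<in> cls Z Y'"
      "coef ((`) (\<lambda>v. if v \<in> Y then h v else v) ` F) mod q = coef F mod q"
      by (simp_all add: k_def[abs_def])
  qed
  \<comment> \<open>Monomials are grouped by the trace \<open>Y\<close> of their vertex set on one block \<open>I\<close> that they must meet.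
    As \<open>I\<close> is convex in \<open>M\<close>, moving \<open>Y\<close> inside \<open>I\<close> keeps the order type, so only \<open>card Y\<close> matters.\<close>
  define G where "G Z Y = (\<Sum>F\<in>cls Z Y. coef F)" for Z Y
  have "q dvd (\<Sum>Y\<in>Pow I. G Z Y)" for Z
  proof (rule sum_Pow_cong_0[where r = "2 * t"])
    show "finite I" by fact
    show "q dvd int (card I choose j)" if "1 \<le> j" "j \<le> 2 * t" for j
      using dvd[OF that] bspec[OF s p'(3)] by (simp add: I_def)
    show "G Z {} = 0"
    proof -
      have "\<Union>F \<inter> I \<noteq> {}" if "F \<in> \<F>" for F
      proof -
        have "p' \<in> (`) \<pi> ` F" using that p'(1) by (simp add: \<F>_def)
        then obtain p where "p \<in> F" "p' = \<pi> ` p" by blast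
        then show ?thesis using p' by (auto simp: I_def)
      qed
      then have "cls Z {} = {}" by (auto simp: cls_def)
      then show ?thesis by (simp add: G_def)
    qed
    show "G Z Y = 0" if "2 * t < card Y" for Y
    proof -
      have "card Y \<le> card (\<Union>F)" if "F \<in> cls Z Y" for F
        using that sub finM by (intro card_mono) (auto simp: cls_def intro: finite_subset)
      then have "cls Z Y = {}" using small that by (fastforce simp: cls_def)
      then show ?thesis by (simp add: G_def)
    qed
    show "G Z Y mod q = G Z Y' mod q" if Y: "Y \<subseteq> I" "Y' \<subseteq> I" "card Y = card Y'" for Y Y'
    proof -
      have "finite Y" "finite Y'" using Y finI finite_subset by blast+
      then obtain a b where ab: "strict_mono_on Y a" "a ` Y = Y'" "strict_mono_on Y' b" "b ` Y' = Y"
        "\<And>v. v \<in> Y \<Longrightarrow> b (a v) = v" "\<And>v. v \<in> Y' \<Longrightarrow> a (b v) = v"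
        using ex_order_iso Y(3) by metis
      define k where "k v = (if v \<in> Y then a v else v)" for v
      define l where "l v = (if v \<in> Y' then b v else v)" for v
      note k = shift[OF Y(1,2) ab(1,2), folded k_def]
      note l = shift[OF Y(2,1) ab(3,4), folded l_def]
      \<comment> \<open>Together with \<open>kl\<close> this makes the two shifts inverse bijections
        between the classes of \<open>Y\<close> and \<open>Y'\<close>, so the sums can be compared
        term by term modulo \<open>q\<close>.\<close>
      have lk: "(`) l ` (`) k ` F = F" if "F \<in> cls Z Y" for F
      proof -
        have "l (k v) = v" if "v \<in> \<Union>F" for v
        proof (cases "v \<in> Y")
          case True
          then have "a v \<in> Y'" using ab(2) by blast
          then show ?thesis using True ab(5) by (simp add: k_def l_def)
        next
          case False
          then have "v \<notin> I" using \<open>F \<in> cls Z Y\<close> that by (auto simp: cls_def)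
          then show ?thesis using False Y by (auto simp: k_def l_def)
        qed
        then have "(`) (\<lambda>v. l (k v)) ` F = (`) (\<lambda>v. v) ` F" by (rule image_image_cong_on)
        then show ?thesis by (simp add: image_image)
      qed
      have kl: "(`) k ` (`) l ` F = F" if "F \<in> cls Z Y'" for F
      proof -
        have "k (l v) = v" if "v \<in> \<Union>F" for v
        proof (cases "v \<in> Y'")
          case True
          then have "b v \<in> Y" using ab(4) by blast
          then show ?thesis using True ab(6) by (simp add: k_def l_def)
        next
          case False
          then have "v \<notin> I" using \<open>F \<in> cls Z Y'\<close> that by (auto simp: cls_def)
          then show ?thesis using False Y by (auto simp: k_def l_def)
        qed
        then have "(`) (\<lambda>v. k (l v)) ` F = (`) (\<lambda>v. v) ` F" by (rule image_image_cong_on)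
        then show ?thesis by (simp add: image_image)
      qed
      have "G Z Y' = (\<Sum>F\<in>cls Z Y. coef ((`) k ` F))"
        unfolding G_def
        by (rule sum.reindex_bij_witness[where i = "\<lambda>F. (`) k ` F" and j = "\<lambda>F. (`) l ` F"])
           (use k(1) l(1) lk kl in auto)
      also have "\<dots> mod q = (\<Sum>F\<in>cls Z Y. coef ((`) k ` F) mod q) mod q"
        by (rule mod_sum_eq[symmetric])
      also have "\<dots> = (\<Sum>F\<in>cls Z Y. coef F mod q) mod q"
        by (simp only: k(2) cong: sum.cong)
      also have "\<dots> = G Z Y mod q"
        unfolding G_def by (rule mod_sum_eq)
      finally show ?thesis by simp
    qed
  qed
  moreover have "(\<Sum>F\<in>\<F>. coef F) = (\<Sum>Z\<in>(\<lambda>F. \<Union>F - I) ` \<F>. \<Sum>Y\<in>Pow I. G Z Y)"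
  proof -
    have "(\<Sum>F\<in>\<F>. coef F) = (\<Sum>Z\<in>(\<lambda>F. \<Union>F - I) ` \<F>. \<Sum>F | F \<in> \<F> \<and> \<Union>F - I = Z. coef F)"
      by (rule sum.group[symmetric]) (use fin in auto)
    also have "\<dots> = (\<Sum>Z\<in>(\<lambda>F. \<Union>F - I) ` \<F>. \<Sum>Y\<in>Pow I. G Z Y)"
    proof (rule sum.cong[OF refl])
      fix Z
      have "(\<Sum>F | F \<in> \<F> \<and> \<Union>F - I = Z. coef F)
        = (\<Sum>Y\<in>Pow I. \<Sum>F | F \<in> {F \<in> \<F>. \<Union>F - I = Z} \<and> \<Union>F \<inter> I = Y. coef F)"
        by (rule sum.group[symmetric]) (use fin finI in auto)
      then show "(\<Sum>F | F \<in> \<F> \<and> \<Union>F - I = Z. coef F) = (\<Sum>Y\<in>Pow I. G Z Y)"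
        by (simp add: G_def cls_def conj_assoc)
    qed
    finally show ?thesis .
  qed
  ultimately show ?thesis unfolding \<F>_def[symmetric] by (simp add: dvd_sum)
qed

text \<open>The order of quantifiers matters: \<open>N\<close> and \<open>L\<close> are chosen
  before \<open>n\<close>, \<open>B\<close> and \<open>coef\<close>. The proportion of the cube
  caught by such a map will be bounded in terms of \<open>L\<close> alone.\<close>

lemma ex_top_cancelling_block_map:
  assumes "q > 0"
  shows "\<exists>N L. \<forall>n B coef. B \<subseteq> {1..n} \<longrightarrow> N \<le> card B \<longrightarrow>
    (\<exists>\<pi>. block_map n m \<pi> \<and> {v. \<pi> v \<noteq> 0} \<subseteq> B \<and> card {v. \<pi> v \<noteq> 0} = L \<and>
      (\<forall>F'. F' \<subseteq> pairs m \<longrightarrow> card F' = Suc D \<longrightarrow>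
        int q dvd (\<Sum>F | F \<subseteq> pairs n \<and> card F = Suc D \<and> (`) \<pi> ` F = F'. coef F)))"
proof -
  \<comment> \<open>With this block size all \<open>s choose j\<close> with
    \<open>1 \<le> j \<le> 2 * Suc D\<close> are multiples of \<open>q\<close>.\<close>
  define s where "s = q * fact (2 * Suc D)"
  have "s > 0" using assms by (simp add: s_def)
  have "int q > 0" using assms by simp
  from order_homogeneous_subset[OF this, of "m * s" "2 * Suc D"]
  obtain N where N: "\<forall>(B::nat set) coef. finite B \<longrightarrow> N \<le> card B \<longrightarrow>
       (\<exists>M\<subseteq>B. card M = m * s \<and>
         (\<forall>F h. F \<subseteq> Pow M \<longrightarrow> card (\<Union>F) \<le> 2 * Suc D \<longrightarrow> strict_mono_on (\<Union>F) h \<longrightarrow> h ` \<Union>F \<subseteq> M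
            \<longrightarrow> coef ((`) h ` F) mod int q = coef F mod int q))" ..
  show ?thesis
  proof (rule exI[of _ N], rule exI[of _ "m * s"], intro allI impI)
    fix n :: nat and B and coef :: "nat set set \<Rightarrow> int"
    assume B: "B \<subseteq> {1..n}" "N \<le> card B"
    have "finite B" by (rule finite_subset[OF B(1)]) simp
    from N[rule_format, OF this B(2), of coef]
    obtain M where M: "M \<subseteq> B" "card M = m * s" and hom_all: "\<forall>F h. F \<subseteq> Pow M \<longrightarrow>
        card (\<Union>F) \<le> 2 * Suc D \<longrightarrow> strict_mono_on (\<Union>F) h \<longrightarrow> h ` \<Union>F \<subseteq> M \<longrightarrow>
        coef ((`) h ` F) mod int q = coef F mod int q"
      by (elim exE conjE) (rule that)
    note hom = hom_all[rule_format]
    have Mn: "M \<subseteq> {1..n}" using M B by blast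
    obtain \<pi> where \<pi>: "block_map n m \<pi>" "{v. \<pi> v \<noteq> 0} = M" "\<forall>i\<in>{1..m}. card {v. \<pi> v = i} = s"
      using ex_equal_blocks[OF Mn M(2) \<open>s > 0\<close>] .
    have "int q dvd (\<Sum>F | F \<subseteq> pairs n \<and> card F = Suc D \<and> (`) \<pi> ` F = F'. coef F)"
      if F': "F' \<subseteq> pairs m" "card F' = Suc D" for F'
    proof (rule top_coefficients_dvd[OF Mn hom \<pi>])
      show "int q dvd int (s choose j)" if "1 \<le> j" "j \<le> 2 * Suc D" for j
        unfolding s_def using dvd_binomial_mult_fact[OF that] by simp
      show "F' \<noteq> {}" using F' by auto
    qed (use F' in auto)
    then show "\<exists>\<pi>. block_map n m \<pi> \<and> {v. \<pi> v \<noteq> 0} \<subseteq> B \<and> card {v. \<pi> v \<noteq> 0} = m * s \<and>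
      (\<forall>F'. F' \<subseteq> pairs m \<longrightarrow> card F' = Suc D \<longrightarrow>
        int q dvd (\<Sum>F | F \<subseteq> pairs n \<and> card F = Suc D \<and> (`) \<pi> ` F = F'. coef F))"
      using \<pi> M by blast
  qed
qed

section \<open>Almost covers\<close>

text \<open>Among the points not caught by earlier maps, the next one catches a proportion of at
  least \<open>1 / 2 ^ 2 ^ L\<close>. Disjoint supports share no pair, so changing coordinates
  inside one support does not affect the others; the uncaught part therefore shrinks
  geometrically.\<close>

lemma disjoint_block_maps_cover:
  assumes \<pi>: "\<And>j. j < r \<Longrightarrow> block_map n m (\<pi> j)"
    and W: "\<And>j. j < r \<Longrightarrow> finite {v. \<pi> j v \<noteq> 0}" "\<And>j. j < r \<Longrightarrow> card {v. \<pi> j v \<noteq> 0} = L"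
    and disj: "\<And>i j v. \<lbrakk>i < r; j < r; i \<noteq> j; \<pi> i v \<noteq> 0\<rbrakk> \<Longrightarrow> \<pi> j v = 0"
  obtains \<V> where
    "\<forall>V\<in>\<V>. \<exists>j<r. \<exists>c\<in>cube n. V = emb n (\<pi> j) c ` cube m"
    "pairwise disjnt \<V>"
    "real (card (cube n - \<Union>\<V>)) \<le> (1 - 1 / 2 ^ 2 ^ L) ^ r * real (card (cube n))"
proof -
  define inner where "inner j p \<longleftrightarrow> p \<in> pairs n \<and> 0 \<notin> \<pi> j ` p" for j p
  \<comment> \<open>\<open>C j\<close> is the union of all subspaces with block map
    \<open>\<pi> j\<close>, and \<open>U j\<close> is what the first \<open>j\<close> of these
    unions leave uncovered.\<close>
  define C where "C j = {x \<in> cube n. \<exists>y\<in>cube m. \<forall>p. inner j p \<longrightarrow> x p = y (\<pi> j ` p)}" for j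
  define U where "U j = {x \<in> cube n. \<forall>i<j. x \<notin> C i}" for j
  define V where "V j x = emb n (\<pi> j) x ` cube m" for j x
  \<comment> \<open>Every point is assigned to the first \<open>j\<close> for which it is blown up from \<open>cube m\<close>; disjointness of
    the supports makes \<open>U j\<close> invariant along \<open>V j x\<close>.\<close>
  define \<V> where "\<V> = {V j x | j x. j < r \<and> x \<in> C j \<inter> U j}"
  have C_cong: "z \<in> C i" if "x \<in> C i" "z \<in> cube n" "\<And>p. inner i p \<Longrightarrow> x p = z p" for i x z
    using that by (auto simp: C_def)
  have outer: "\<not> inner j p" if "inner i p" "i \<noteq> j" "i < r" "j < r" for i j p
  proof
    assume "inner j p"
    with that(1) obtain v where v: "v \<in> p" "0 \<notin> \<pi> i ` p" "0 \<notin> \<pi> j ` p"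
      unfolding inner_def pairs_def by blast
    then have nz: "\<pi> i v \<noteq> 0" "\<pi> j v \<noteq> 0" by (metis imageI)+
    show False using disj[OF that(3,4,2) nz(1)] nz(2) by simp
  qed
  \<comment> \<open>Any point of a subspace generates it, so two chosen subspaces with the same
    \<open>j\<close> that meet are equal. For different indices the sets
    \<open>C j \<inter> U j\<close> are disjoint.\<close>
  have V_mem: "z \<in> C j \<inter> U j \<and> V j z = V j x" if "z \<in> V j x" "x \<in> C j \<inter> U j" "j < r" for j x z
  proof -
    obtain y where y: "y \<in> cube m" "z = emb n (\<pi> j) x y" using \<open>z \<in> V j x\<close> by (auto simp: V_def)
    have x: "x \<in> cube n" using that by (simp add: C_def)
    have z: "z \<in> cube n" using x y emb_in_cube by simp
    have eq: "z p = x p" if "\<not> inner j p" for p using that unfolding y(2) emb_def inner_def by presburger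
    have "z \<in> C j"
      using z y unfolding C_def inner_def emb_def by auto
    moreover have "z \<notin> C i" if "i < j" for i
    proof
      assume "z \<in> C i"
      moreover have "z p = x p" if "inner i p" for p
        using eq outer[OF that, of j] \<open>i < j\<close> \<open>j < r\<close> by simp
      ultimately have "x \<in> C i" using C_cong x by blast
      then show False using \<open>x \<in> C j \<inter> U j\<close> that by (auto simp: U_def)
    qed
    moreover have "emb n (\<pi> j) z y' = emb n (\<pi> j) x y'" for y'
      by (rule ext) (auto simp: emb_def y(2))
    ultimately show ?thesis using z by (auto simp: U_def V_def)
  qed
  have x_V: "x \<in> V j x" if x: "x \<in> C j" for j x
  proof -
    obtain y where y: "y \<in> cube m" "\<And>p. inner j p \<Longrightarrow> x p = y (\<pi> j ` p)"
      using x by (auto simp: C_def)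
    have "x = emb n (\<pi> j) x y" using y(2) by (intro ext) (simp add: emb_def inner_def)
    then show ?thesis using y(1) by (auto simp: V_def)
  qed
  have UV: "\<Union>\<V> = {x \<in> cube n. \<exists>j<r. x \<in> C j}"
  proof (intro equalityI subsetI)
    fix x assume "x \<in> \<Union>\<V>"
    then obtain j z where "j < r" "z \<in> C j \<inter> U j" "x \<in> V j z" by (auto simp: \<V>_def)
    with V_mem[of x j z] show "x \<in> {x \<in> cube n. \<exists>j<r. x \<in> C j}" by (auto simp: C_def)
  next
    fix x assume "x \<in> {x \<in> cube n. \<exists>j<r. x \<in> C j}"
    then have x: "x \<in> cube n" "\<exists>j. j < r \<and> x \<in> C j" by auto
    then obtain j where j: "j < r" "x \<in> C j" "\<And>i. i < j \<Longrightarrow> \<not> (i < r \<and> x \<in> C i)"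
      using exists_least_iff[of "\<lambda>j. j < r \<and> x \<in> C j"] by blast
    then have "x \<in> C j \<inter> U j" using x by (auto simp: U_def)
    then show "x \<in> \<Union>\<V>" using x_V j(1) by (auto simp: \<V>_def)
  qed
  have step: "real (card (U (Suc j))) \<le> (1 - 1 / 2 ^ 2 ^ L) * real (card (U j))" if j: "j < r" for j
  proof -
    define W where "W = {v. \<pi> j v \<noteq> 0}"
    define clr where "clr x p = (x p \<and> \<not> inner j p)" for x p
    have finU: "finite (U j)" using finite_cube by (auto simp: U_def)
    have inW: "p \<subseteq> W" if "inner j p" for p
      using that by (auto simp: W_def inner_def)
    \<comment> \<open>Clearing the coordinates inside \<open>W\<close> lands in \<open>C j\<close> and is at most \<open>2 ^ 2 ^ L\<close> to one.\<close>
    have "inj_on (\<lambda>x. (clr x, {p \<in> Pow W. x p})) (U j)"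
    proof (rule inj_onI, rule ext)
      fix x z p assume eq: "(clr x, {p \<in> Pow W. x p}) = (clr z, {p \<in> Pow W. z p})"
      then have "clr x p = clr z p" "p \<in> {p \<in> Pow W. x p} \<longleftrightarrow> p \<in> {p \<in> Pow W. z p}" by auto
      then show "x p = z p" using inW[of p] by (auto simp: clr_def)
    qed
    moreover have "(\<lambda>x. (clr x, {p \<in> Pow W. x p})) ` U j \<subseteq> (U j \<inter> C j) \<times> Pow (Pow W)"
    proof (rule image_subsetI)
      fix x assume x: "x \<in> U j"
      have cx: "clr x \<in> cube n" using x by (auto simp: U_def cube_def clr_def)
      have "clr x \<notin> C i" if "i < j" for i
      proof
        assume "clr x \<in> C i"
        moreover have "clr x p = x p" if "inner i p" for p
          using outer[OF that, of j] \<open>i < j\<close> j by (auto simp: clr_def)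
        ultimately have "x \<in> C i" using C_cong[of "clr x" i x] x by (auto simp: U_def)
        then show False using x that by (auto simp: U_def)
      qed
      \<comment> \<open>After clearing, all inner coordinates are false, so the zero point of
        \<open>cube m\<close> is a witness.\<close>
      moreover have "clr x \<in> C j"
        using cx by (auto simp: C_def clr_def cube_def intro!: bexI[of _ "\<lambda>_. False"])
      ultimately show "(clr x, {p \<in> Pow W. x p}) \<in> (U j \<inter> C j) \<times> Pow (Pow W)"
        using cx by (auto simp: U_def)
    qed
    moreover have "finite ((U j \<inter> C j) \<times> Pow (Pow W))"
      using finU W(1)[OF j] by (simp add: W_def)
    ultimately have "card (U j) \<le> card ((U j \<inter> C j) \<times> Pow (Pow W))"
      by (rule card_inj_on_le)
    \<comment> \<open>\<open>W\<close> has \<open>2 ^ L\<close> subsets, hence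
      \<open>2 ^ 2 ^ L\<close> is the number of families of subsets of \<open>W\<close>.\<close>
    also have "\<dots> = card (U j \<inter> C j) * 2 ^ 2 ^ L"
      using W[OF j] by (simp add: card_cartesian_product card_Pow W_def)
    finally have "real (card (U j)) \<le> real (card (U j \<inter> C j) * 2 ^ 2 ^ L)"
      by (rule of_nat_mono)
    then have "real (card (U j)) / 2 ^ 2 ^ L \<le> real (card (U j \<inter> C j))"
      by (simp add: divide_le_eq)
    moreover have "card (U (Suc j)) + card (U j \<inter> C j) = card (U j)"
    proof -
      have "U (Suc j) = U j - (U j \<inter> C j)" by (auto simp: U_def less_Suc_eq)
      then show ?thesis
        using finU by (simp add: card_Diff_subset card_mono)
    qed
    ultimately show ?thesis by (simp add: algebra_simps flip: of_nat_add)
  qed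
  have le: "real (card (U j)) \<le> (1 - 1 / 2 ^ 2 ^ L) ^ j * real (card (cube n))" if "j \<le> r" for j
    using that
  proof (induction j)
    case 0
    then show ?case by (simp add: U_def)
  next
    case (Suc j)
    have "real (card (U (Suc j))) \<le> (1 - 1 / 2 ^ 2 ^ L) * real (card (U j))" using step Suc by simp
    also have "\<dots> \<le> (1 - 1 / 2 ^ 2 ^ L) * ((1 - 1 / 2 ^ 2 ^ L) ^ j * real (card (cube n)))"
      using Suc by (intro mult_left_mono) auto
    finally show ?case by simp
  qed
  show thesis
  proof (rule that)
    show "\<forall>V\<in>\<V>. \<exists>j<r. \<exists>c\<in>cube n. V = emb n (\<pi> j) c ` cube m"
      by (auto simp: \<V>_def V_def C_def)
    show "pairwise disjnt \<V>"
    proof (rule pairwiseI)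
      fix A B assume AB: "A \<in> \<V>" "B \<in> \<V>" "A \<noteq> B"
      then obtain i x j z where A: "A = V i x" "i < r" "x \<in> C i \<inter> U i"
        and B: "B = V j z" "j < r" "z \<in> C j \<inter> U j" by (auto simp: \<V>_def)
      have False if w: "w \<in> A" "w \<in> B" for w
      proof -
        have i: "w \<in> C i \<inter> U i" "V i w = A" using V_mem[of w i x] A w by auto
        have j: "w \<in> C j \<inter> U j" "V j w = B" using V_mem[of w j z] B w by auto
        have "i = j" using i(1) j(1) by (auto simp: U_def intro: linorder_cases[of i j])
        then show False using i j AB by simp
      qed
      then show "disjnt A B" by (auto simp: disjnt_def)
    qed
    have "cube n - \<Union>\<V> = U r" unfolding UV by (auto simp: U_def)
    then show "real (card (cube n - \<Union>\<V>)) \<le> (1 - 1 / 2 ^ 2 ^ L) ^ r * real (card (cube n))"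
      using le[of r] by simp
  qed
qed

text \<open>The number \<open>r\<close> of attempts is fixed first, from \<open>L\<close> and
  \<open>\<eta>\<close>. Then \<open>r\<close> consecutive intervals of length \<open>N\<close>
  supply block maps with disjoint supports, which is why \<open>r * N\<close> vertices
  suffice.\<close>

lemma degree_lowering_cover:
  fixes \<eta> :: real
  assumes "\<eta> > 0" "q > 0"
  shows "\<exists>n0. \<forall>n\<ge>n0. \<forall>coef. \<exists>\<V>.
    (\<forall>V\<in>\<V>. \<exists>\<pi> c coef'. block_map n m \<pi> \<and> c \<in> cube n \<and> V = emb n \<pi> c ` cube m \<and>
       (\<forall>y. multilinear n (Suc D) coef (emb n \<pi> c y) mod int q = multilinear m D coef' y mod int q)) \<and>
    pairwise disjnt \<V> \<and> real (card (cube n - \<Union>\<V>)) \<le> \<eta> * real (card (cube n))"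
proof -
  from ex_top_cancelling_block_map[OF \<open>q > 0\<close>, of m D]
  obtain N L where NL: "\<forall>n B coef. B \<subseteq> {1..n} \<longrightarrow> N \<le> card B \<longrightarrow>
    (\<exists>\<pi>. block_map n m \<pi> \<and> {v. \<pi> v \<noteq> 0} \<subseteq> B \<and> card {v. \<pi> v \<noteq> 0} = L \<and>
      (\<forall>F'. F' \<subseteq> pairs m \<longrightarrow> card F' = Suc D \<longrightarrow>
        int q dvd (\<Sum>F | F \<subseteq> pairs n \<and> card F = Suc D \<and> (`) \<pi> ` F = F'. coef F)))"
    by (elim exE) (rule that)
  obtain r where r: "(1 - 1 / 2 ^ 2 ^ L) ^ r < \<eta>"
    using real_arch_pow_inv[OF \<open>\<eta> > 0\<close>, of "1 - 1 / 2 ^ 2 ^ L"] by auto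
  show ?thesis
  proof (intro exI[of _ "r * N"] allI impI)
    fix n :: nat and coef :: "nat set set \<Rightarrow> int"
    assume n: "r * N \<le> n"
    define B where "B j = {j * N + 1..Suc j * N}" for j
    have "\<forall>j\<in>{..<r}. \<exists>\<pi>. block_map n m \<pi> \<and> {v. \<pi> v \<noteq> 0} \<subseteq> B j \<and> card {v. \<pi> v \<noteq> 0} = L \<and>
      (\<forall>F'. F' \<subseteq> pairs m \<longrightarrow> card F' = Suc D \<longrightarrow>
        int q dvd (\<Sum>F | F \<subseteq> pairs n \<and> card F = Suc D \<and> (`) \<pi> ` F = F'. coef F))"
    proof
      fix j assume "j \<in> {..<r}"
      then have "Suc j * N \<le> r * N" by (intro mult_le_mono1) simp
      then have "B j \<subseteq> {1..n}" using n by (auto simp: B_def)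
      moreover have "N \<le> card (B j)" by (simp add: B_def)
      ultimately show "\<exists>\<pi>. block_map n m \<pi> \<and> {v. \<pi> v \<noteq> 0} \<subseteq> B j \<and> card {v. \<pi> v \<noteq> 0} = L \<and>
      (\<forall>F'. F' \<subseteq> pairs m \<longrightarrow> card F' = Suc D \<longrightarrow>
        int q dvd (\<Sum>F | F \<subseteq> pairs n \<and> card F = Suc D \<and> (`) \<pi> ` F = F'. coef F))"
        using NL[rule_format, of "B j" n coef] by simp
    qed
    from bchoice[OF this] obtain \<pi> where
      \<pi>: "\<forall>j\<in>{..<r}. block_map n m (\<pi> j) \<and> {v. \<pi> j v \<noteq> 0} \<subseteq> B j \<and> card {v. \<pi> j v \<noteq> 0} = L \<and>
      (\<forall>F'. F' \<subseteq> pairs m \<longrightarrow> card F' = Suc D \<longrightarrow>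
        int q dvd (\<Sum>F | F \<subseteq> pairs n \<and> card F = Suc D \<and> (`) (\<pi> j) ` F = F'. coef F))"
      by (elim exE) (rule that)
    have B_disj: "i = j" if "v \<in> B i" "v \<in> B j" for i j v
    proof (rule ccontr)
      assume "i \<noteq> j"
      then consider "Suc i \<le> j" | "Suc j \<le> i" by linarith
      then show False
      proof cases
        case 1
        then have "Suc i * N \<le> j * N" by (rule mult_le_mono1)
        then show False using that by (simp add: B_def)
      next
        case 2
        then have "Suc j * N \<le> i * N" by (rule mult_le_mono1)
        then show False using that by (simp add: B_def)
      qed
    qed
    have bm: "block_map n m (\<pi> j)" if "j < r" for j using \<pi> that by blast
    have sup: "{v. \<pi> j v \<noteq> 0} \<subseteq> B j" "card {v. \<pi> j v \<noteq> 0} = L" if "j < r" for j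
      using \<pi> that by blast+
    have fin: "finite {v. \<pi> j v \<noteq> 0}" if "j < r" for j
      by (rule finite_subset[OF sup(1)[OF that]]) (simp add: B_def)
    have disj: "\<pi> j v = 0" if ij: "i < r" "j < r" "i \<noteq> j" and v: "\<pi> i v \<noteq> 0" for i j v
    proof (rule ccontr)
      assume "\<pi> j v \<noteq> 0"
      then have "v \<in> B i" "v \<in> B j" using sup(1)[OF ij(1)] sup(1)[OF ij(2)] v by auto
      then show False using B_disj ij(3) by blast
    qed
    obtain \<V> where \<V>: "\<forall>V\<in>\<V>. \<exists>j<r. \<exists>c\<in>cube n. V = emb n (\<pi> j) c ` cube m"
      "pairwise disjnt \<V>"
      "real (card (cube n - \<Union>\<V>)) \<le> (1 - 1 / 2 ^ 2 ^ L) ^ r * real (card (cube n))"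
      by (rule disjoint_block_maps_cover[where r = r and n = n and m = m and \<pi> = \<pi> and L = L,
            OF bm fin sup(2) disj])
    have lower: "\<exists>\<pi> c coef'. block_map n m \<pi> \<and> c \<in> cube n \<and> V = emb n \<pi> c ` cube m \<and>
       (\<forall>y. multilinear n (Suc D) coef (emb n \<pi> c y) mod int q = multilinear m D coef' y mod int q)"
      if V: "V \<in> \<V>" for V
    proof -
      obtain j c where jc: "j < r" "c \<in> cube n" "V = emb n (\<pi> j) c ` cube m"
        using \<V>(1) V by blast
      have "\<exists>coef'. \<forall>y. multilinear n (Suc D) coef (emb n (\<pi> j) c y) mod int q
          = multilinear m D coef' y mod int q"
        by (rule multilinear_emb[OF bm[OF jc(1)]]) (use \<pi> jc(1) in blast)
      then show ?thesis using jc bm by blast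
    qed
    have "(1 - 1 / 2 ^ 2 ^ L) ^ r * real (card (cube n)) \<le> \<eta> * real (card (cube n))"
      using r by (intro mult_right_mono) auto
    with \<V>(2,3) lower show "\<exists>\<V>.
    (\<forall>V\<in>\<V>. \<exists>\<pi> c coef'. block_map n m \<pi> \<and> c \<in> cube n \<and> V = emb n \<pi> c ` cube m \<and>
       (\<forall>y. multilinear n (Suc D) coef (emb n \<pi> c y) mod int q = multilinear m D coef' y mod int q)) \<and>
    pairwise disjnt \<V> \<and> real (card (cube n - \<Union>\<V>)) \<le> \<eta> * real (card (cube n))"
      by (intro exI[of _ \<V>] conjI ballI) auto
  qed
qed

section \<open>Refinement of covers and induction on the degree\<close>

text \<open>A point missed by the refinement is either missed by the original family or lies in some
  \<open>V\<close> and is missed there. Since the sets \<open>V\<close> are disjoint, the second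
  kind amounts to at most \<open>\<epsilon>\<close> times the size of their union.\<close>

lemma refine_cover:
  fixes \<delta> \<epsilon> :: real
  assumes "finite X" and \<V>: "\<Union>\<V> \<subseteq> X" "pairwise disjnt \<V>" "real (card (X - \<Union>\<V>)) \<le> \<delta> * real (card X)"
    and "0 \<le> \<epsilon>"
    and \<W>: "\<And>V. V \<in> \<V> \<Longrightarrow> \<Union>(\<W> V) \<subseteq> V \<and> pairwise disjnt (\<W> V)
          \<and> real (card (V - \<Union>(\<W> V))) \<le> \<epsilon> * real (card V)"
  shows "pairwise disjnt (\<Union>(\<W> ` \<V>))"
    and "real (card (X - \<Union>(\<Union>(\<W> ` \<V>)))) \<le> (\<delta> + \<epsilon>) * real (card X)"
proof -
  show "pairwise disjnt (\<Union>(\<W> ` \<V>))"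
  proof (rule pairwiseI)
    fix A B assume AB: "A \<in> \<Union>(\<W> ` \<V>)" "B \<in> \<Union>(\<W> ` \<V>)" "A \<noteq> B"
    then obtain V W where VW: "V \<in> \<V>" "A \<in> \<W> V" "W \<in> \<V>" "B \<in> \<W> W" by blast
    show "disjnt A B"
    proof (cases "V = W")
      case True
      then show ?thesis using VW AB \<W>[of V] by (auto simp: pairwise_def)
    next
      case False
      then have "disjnt V W" using \<V>(2) VW by (auto simp: pairwise_def)
      moreover have "A \<subseteq> V" "B \<subseteq> W" using VW \<W>[of V] \<W>[of W] by auto
      ultimately show ?thesis by (auto simp: disjnt_def)
    qed
  qed
  have fin: "finite V" if "V \<in> \<V>" for V
    using that \<V>(1) \<open>finite X\<close> by (meson Union_upper finite_subset)
  have fin\<V>: "finite \<V>"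
    using \<V>(1) \<open>finite X\<close> by (meson finite_UnionD finite_subset)
  have "X - \<Union>(\<Union>(\<W> ` \<V>)) \<subseteq> (X - \<Union>\<V>) \<union> (\<Union>V\<in>\<V>. V - \<Union>(\<W> V))" by auto
  then have "card (X - \<Union>(\<Union>(\<W> ` \<V>))) \<le> card ((X - \<Union>\<V>) \<union> (\<Union>V\<in>\<V>. V - \<Union>(\<W> V)))"
    using \<open>finite X\<close> fin fin\<V> by (intro card_mono) auto
  also have "\<dots> \<le> card (X - \<Union>\<V>) + card (\<Union>V\<in>\<V>. V - \<Union>(\<W> V))" by (rule card_Un_le)
  also have "\<dots> \<le> card (X - \<Union>\<V>) + (\<Sum>V\<in>\<V>. card (V - \<Union>(\<W> V)))"
    using card_UN_le[OF fin\<V>] by simp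
  finally have "real (card (X - \<Union>(\<Union>(\<W> ` \<V>))))
      \<le> real (card (X - \<Union>\<V>)) + (\<Sum>V\<in>\<V>. real (card (V - \<Union>(\<W> V))))"
    by (simp flip: of_nat_sum of_nat_add)
  also have "\<dots> \<le> \<delta> * real (card X) + (\<Sum>V\<in>\<V>. \<epsilon> * real (card V))"
    using \<V>(3) \<W> by (intro add_mono sum_mono) auto
  also have "(\<Sum>V\<in>\<V>. \<epsilon> * real (card V)) = \<epsilon> * real (card (\<Union>\<V>))"
    using card_Union_disjoint[OF \<V>(2)] fin by (simp add: sum_distrib_left)
  also have "\<dots> \<le> \<epsilon> * real (card X)"
    using \<open>0 \<le> \<epsilon>\<close> \<V>(1) \<open>finite X\<close> by (intro mult_left_mono of_nat_mono card_mono) auto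
  finally show "real (card (X - \<Union>(\<Union>(\<W> ` \<V>)))) \<le> (\<delta> + \<epsilon>) * real (card X)"
    by (simp add: algebra_simps)
qed

lemma multilinear_0: "multilinear n 0 coef x = coef {}"
proof -
  have "F = {}" if "F \<subseteq> pairs n" "card F \<le> 0" for F
    using that finite_subset[OF that(1) finite_pairs] by simp
  then have "{F. F \<subseteq> pairs n \<and> card F \<le> 0} = {{}}" by auto
  then show ?thesis by (simp add: multilinear_def)
qed

text \<open>Induction on the degree, with the error split in halves between lowering the degree by
  one and covering each resulting subspace by smaller ones.\<close>

lemma constant_cover:
  fixes \<eta> :: real
  assumes "\<eta> > 0" "q > 0"
  shows "\<exists>n0. \<forall>n\<ge>n0. \<forall>coef. \<exists>\<V>.
    (\<forall>V\<in>\<V>. \<exists>\<pi> c a. block_map n m \<pi> \<and> c \<in> cube n \<and> V = emb n \<pi> c ` cube m \<and>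
       (\<forall>x\<in>V. multilinear n D coef x mod int q = a)) \<and>
    pairwise disjnt \<V> \<and> real (card (cube n - \<Union>\<V>)) \<le> \<eta> * real (card (cube n))"
  using assms(1)
proof (induction D arbitrary: \<eta>)
  case 0
  \<comment> \<open>A polynomial of degree 0 is constant everywhere; this supplies the almost cover
    by \<open>m\<close>-dimensional subspaces.\<close>
  from degree_lowering_cover[OF 0 \<open>q > 0\<close>, of m 0]
  obtain n0 where n0: "\<And>n coef. n0 \<le> n \<Longrightarrow> \<exists>\<V>.
    (\<forall>V\<in>\<V>. \<exists>\<pi> c coef'. block_map n m \<pi> \<and> c \<in> cube n \<and> V = emb n \<pi> c ` cube m \<and>
       (\<forall>y. multilinear n (Suc 0) coef (emb n \<pi> c y) mod int q = multilinear m 0 coef' y mod int q)) \<and>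
    pairwise disjnt \<V> \<and> real (card (cube n - \<Union>\<V>)) \<le> \<eta> * real (card (cube n))" by metis
  show ?case
  proof (intro exI[of _ n0] allI impI)
    fix n :: nat and coef :: "nat set set \<Rightarrow> int"
    assume "n0 \<le> n"
    from n0[OF this, of coef] obtain \<V> where \<V>: "\<forall>V\<in>\<V>. \<exists>\<pi> c. block_map n m \<pi> \<and> c \<in> cube n \<and> V = emb n \<pi> c ` cube m"
      "pairwise disjnt \<V>" "real (card (cube n - \<Union>\<V>)) \<le> \<eta> * real (card (cube n))" by meson
    then show "\<exists>\<V>.
    (\<forall>V\<in>\<V>. \<exists>\<pi> c a. block_map n m \<pi> \<and> c \<in> cube n \<and> V = emb n \<pi> c ` cube m \<and>
       (\<forall>x\<in>V. multilinear n 0 coef x mod int q = a)) \<and>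
    pairwise disjnt \<V> \<and> real (card (cube n - \<Union>\<V>)) \<le> \<eta> * real (card (cube n))"
      unfolding multilinear_0 by (intro exI[of _ \<V>]) auto
  qed
next
  case (Suc D)
  have \<eta>2: "\<eta> / 2 > 0" using Suc.prems by simp
  from Suc.IH[OF \<eta>2] obtain m' where m': "\<forall>n\<ge>m'. \<forall>coef. \<exists>\<V>.
    (\<forall>V\<in>\<V>. \<exists>\<pi> c a. block_map n m \<pi> \<and> c \<in> cube n \<and> V = emb n \<pi> c ` cube m \<and>
       (\<forall>x\<in>V. multilinear n D coef x mod int q = a)) \<and>
    pairwise disjnt \<V> \<and> real (card (cube n - \<Union>\<V>)) \<le> \<eta> / 2 * real (card (cube n))"
    by (elim exE) (rule that)
  \<comment> \<open>The intermediate dimension is the threshold \<open>m'\<close> of the induction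
    hypothesis, so each subspace found here is just large enough for it. That hypothesis is uniform
    in the coefficients, which vary with the subspace.\<close>
  from degree_lowering_cover[OF \<eta>2 \<open>q > 0\<close>, of m' D]
  obtain n0 where n0: "\<forall>n\<ge>n0. \<forall>coef. \<exists>\<V>.
    (\<forall>V\<in>\<V>. \<exists>\<pi> c coef'. block_map n m' \<pi> \<and> c \<in> cube n \<and> V = emb n \<pi> c ` cube m' \<and>
       (\<forall>y. multilinear n (Suc D) coef (emb n \<pi> c y) mod int q = multilinear m' D coef' y mod int q)) \<and>
    pairwise disjnt \<V> \<and> real (card (cube n - \<Union>\<V>)) \<le> \<eta> / 2 * real (card (cube n))"
    by (elim exE) (rule that)
  show ?case
  proof (intro exI[of _ n0] allI impI)
    fix n :: nat and coef :: "nat set set \<Rightarrow> int"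
    assume "n0 \<le> n"
    from n0[rule_format, OF this, of coef] obtain \<V> where
      \<V>: "\<forall>V\<in>\<V>. \<exists>\<pi> c coef'. block_map n m' \<pi> \<and> c \<in> cube n \<and> V = emb n \<pi> c ` cube m' \<and>
       (\<forall>y. multilinear n (Suc D) coef (emb n \<pi> c y) mod int q = multilinear m' D coef' y mod int q)"
      "pairwise disjnt \<V>" "real (card (cube n - \<Union>\<V>)) \<le> \<eta> / 2 * real (card (cube n))"
      by (elim exE conjE) (rule that)
    define good where "good V \<longleftrightarrow> (\<exists>\<pi> c a. block_map n m \<pi> \<and> c \<in> cube n \<and> V = emb n \<pi> c ` cube m \<and>
       (\<forall>x\<in>V. multilinear n (Suc D) coef x mod int q = a))" for V
    have "\<exists>\<W>. (\<forall>W\<in>\<W>. good W) \<and> \<Union>\<W> \<subseteq> V \<and> pairwise disjnt \<W>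
          \<and> real (card (V - \<Union>\<W>)) \<le> \<eta> / 2 * real (card V)" if V: "V \<in> \<V>" for V
    proof -
      from bspec[OF \<V>(1) V] obtain \<pi> c coef' where
        \<pi>: "block_map n m' \<pi>" "c \<in> cube n" "V = emb n \<pi> c ` cube m'"
        "\<forall>y. multilinear n (Suc D) coef (emb n \<pi> c y) mod int q = multilinear m' D coef' y mod int q"
        by (elim exE conjE) (rule that)
      define e where "e = emb n \<pi> c"
      have inj: "inj_on e (cube m')" using inj_on_emb[OF \<pi>(1)] by (simp add: e_def)
      from m'[rule_format, OF order_refl, of coef'] obtain \<W> where
        \<W>: "\<forall>W\<in>\<W>. \<exists>\<rho> c' a. block_map m' m \<rho> \<and> c' \<in> cube m' \<and> W = emb m' \<rho> c' ` cube m \<and>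
          (\<forall>x\<in>W. multilinear m' D coef' x mod int q = a)"
        "pairwise disjnt \<W>" "real (card (cube m' - \<Union>\<W>)) \<le> \<eta> / 2 * real (card (cube m'))"
        by (elim exE conjE) (rule that)
      have sub: "W \<subseteq> cube m'" if W: "W \<in> \<W>" for W
        using bspec[OF \<W>(1) W] emb_in_cube by (elim exE conjE) auto
      have "good (e ` W)" if W: "W \<in> \<W>" for W
      proof -
        from bspec[OF \<W>(1) W] obtain \<rho> c' a where
          \<rho>: "block_map m' m \<rho>" "c' \<in> cube m'" "W = emb m' \<rho> c' ` cube m"
          "\<forall>x\<in>W. multilinear m' D coef' x mod int q = a"
          by (elim exE conjE) (rule that)
        have "\<rho> 0 = 0" using \<rho>(1) by (simp add: block_map_def)
        then have "e ` W = emb n (\<rho> \<circ> \<pi>) (e c') ` cube m"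
          unfolding \<rho>(3) e_def image_image using emb_emb[OF \<pi>(1)] by simp
        moreover have "block_map n m (\<rho> \<circ> \<pi>)" by (rule block_map_comp[OF \<pi>(1) \<rho>(1)])
        moreover have "e c' \<in> cube n" unfolding e_def by (rule emb_in_cube[OF \<pi>(2)])
        moreover have "\<forall>x\<in>e ` W. multilinear n (Suc D) coef x mod int q = a"
          using \<pi>(4) \<rho>(4) by (simp add: e_def)
        ultimately show ?thesis unfolding good_def by blast
      qed
      moreover have "\<Union>((`) e ` \<W>) \<subseteq> V" using sub \<pi>(3) by (auto simp: e_def)
      moreover have "pairwise disjnt ((`) e ` \<W>)"
      proof (rule pairwiseI)
        fix A B assume AB: "A \<in> (`) e ` \<W>" "B \<in> (`) e ` \<W>" "A \<noteq> B"
        then obtain A' B' where A'B': "A' \<in> \<W>" "A = e ` A'" "B' \<in> \<W>" "B = e ` B'" by blast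
        then have "disjnt A' B'" using AB(3) \<W>(2) by (auto simp: pairwise_def)
        moreover have "A \<inter> B = e ` (A' \<inter> B')"
          using inj_on_image_Int[OF inj sub[OF A'B'(1)] sub[OF A'B'(3)]] A'B' by simp
        ultimately show "disjnt A B" by (simp add: disjnt_def)
      qed
      moreover have "real (card (V - \<Union>((`) e ` \<W>))) \<le> \<eta> / 2 * real (card V)"
      proof -
        \<comment> \<open>Injectivity of \<open>e\<close> carries disjointness and proportions from
          \<open>cube m'\<close> to \<open>V\<close>.\<close>
        have "V - \<Union>((`) e ` \<W>) = e ` (cube m' - \<Union>\<W>)"
          using inj_on_image_set_diff[OF inj, of "cube m'" "\<Union>\<W>"] sub \<pi>(3)
          by (simp add: e_def image_Union Sup_le_iff)
        moreover have "card (e ` (cube m' - \<Union>\<W>)) = card (cube m' - \<Union>\<W>)"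
          by (rule card_image) (rule inj_on_subset[OF inj], auto)
        moreover have "card V = card (cube m')" using inj \<pi>(3) by (simp add: e_def card_image)
        ultimately show ?thesis using \<W>(3) by simp
      qed
      ultimately show ?thesis by (intro exI[of _ "(`) e ` \<W>"]) blast
    qed
    then have "\<forall>V\<in>\<V>. \<exists>\<W>. (\<forall>W\<in>\<W>. good W) \<and> \<Union>\<W> \<subseteq> V \<and> pairwise disjnt \<W>
          \<and> real (card (V - \<Union>\<W>)) \<le> \<eta> / 2 * real (card V)" ..
    from bchoice[OF this] obtain \<W> where \<W>: "\<forall>V\<in>\<V>. (\<forall>W\<in>\<W> V. good W) \<and> \<Union>(\<W> V) \<subseteq> V
        \<and> pairwise disjnt (\<W> V) \<and> real (card (V - \<Union>(\<W> V))) \<le> \<eta> / 2 * real (card V)"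
      by (elim exE) (rule that)
    have "V \<subseteq> cube n" if "V \<in> \<V>" for V
      using bspec[OF \<V>(1) that] emb_in_cube by (elim exE conjE) auto
    then have "\<Union>\<V> \<subseteq> cube n" by (rule Union_least)
    note refined = refine_cover[OF finite_cube this \<V>(2,3), of "\<eta> / 2" \<W>]
    have "pairwise disjnt (\<Union>(\<W> ` \<V>))" "real (card (cube n - \<Union>(\<Union>(\<W> ` \<V>)))) \<le> \<eta> * real (card (cube n))"
      using refined \<W> Suc.prems by auto
    moreover have "\<forall>W\<in>\<Union>(\<W> ` \<V>). good W" using \<W> by blast
    ultimately show "\<exists>\<V>.
    (\<forall>V\<in>\<V>. \<exists>\<pi> c a. block_map n m \<pi> \<and> c \<in> cube n \<and> V = emb n \<pi> c ` cube m \<and>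
       (\<forall>x\<in>V. multilinear n (Suc D) coef x mod int q = a)) \<and>
    pairwise disjnt \<V> \<and> real (card (cube n - \<Union>\<V>)) \<le> \<eta> * real (card (cube n))"
      unfolding good_def by blast
  qed
qed

section \<open>Translation of integer polynomials and conclusion\<close>

lemma prod_indicator_eq_of_bool:
  "finite F \<Longrightarrow> (\<Prod>e\<in>F. if P e then 1 else 0 :: int) = of_bool (\<forall>e\<in>F. P e)"
  by (induction F rule: finite_induct) auto

lemma int_poly_eq_multilinear:
  assumes "int_poly n k D Q"
  obtains coef where "\<forall>x\<in>cube n. Q x = multilinear n D coef x mod 2 ^ k"
proof -
  obtain \<alpha> coef where Q: "\<And>x. x \<in> cube n \<Longrightarrow> Q x = (\<alpha> + (\<Sum>F\<in>{F. F \<subseteq> pairs n \<and> F \<noteq> {} \<and> card F \<le> D}.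
        coef F * (\<Prod>e\<in>F. if x e then 1 else 0))) mod 2 ^ k"
    using assms unfolding int_poly_def by blast
  \<comment> \<open>The sum in \<open>int_poly\<close> skips the empty set, so that slot is free to
    hold the constant term.\<close>
  define coef' where "coef' = coef({} := \<alpha>)"
  have fin: "finite {F. F \<subseteq> pairs n \<and> F \<noteq> {} \<and> card F \<le> D}" by simp
  have split: "{F. F \<subseteq> pairs n \<and> card F \<le> D} = insert {} {F. F \<subseteq> pairs n \<and> F \<noteq> {} \<and> card F \<le> D}"
    by auto
  have "multilinear n D coef' x
      = \<alpha> + (\<Sum>F\<in>{F. F \<subseteq> pairs n \<and> F \<noteq> {} \<and> card F \<le> D}. coef' F * of_bool (\<forall>e\<in>F. x e))" for x
    unfolding multilinear_def split using fin by (subst sum.insert) (auto simp: coef'_def)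
  moreover have "(\<Sum>F\<in>{F. F \<subseteq> pairs n \<and> F \<noteq> {} \<and> card F \<le> D}. coef' F * of_bool (\<forall>e\<in>F. x e))
      = (\<Sum>F\<in>{F. F \<subseteq> pairs n \<and> F \<noteq> {} \<and> card F \<le> D}. coef F * (\<Prod>e\<in>F. if x e then 1 else 0))" for x
  proof (rule sum.cong[OF refl])
    fix F assume F: "F \<in> {F. F \<subseteq> pairs n \<and> F \<noteq> {} \<and> card F \<le> D}"
    then have "finite F" using finite_subset[OF _ finite_pairs] by blast
    then show "coef' F * of_bool (\<forall>e\<in>F. x e) = coef F * (\<Prod>e\<in>F. if x e then 1 else 0)"
      using F by (subst prod_indicator_eq_of_bool) (auto simp: coef'_def)
  qed
  ultimately have "\<forall>x\<in>cube n. Q x = multilinear n D coef' x mod 2 ^ k" using Q by simp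
  then show thesis by (rule that)
qed

theorem theorem5p5:
  fixes \<eta> :: real and m d :: nat
  assumes "\<eta> > 0" and "m > 0" and "d > 0"
  shows "\<exists>n3::nat. n3 > 0 \<and> (\<forall>n \<ge> n3. \<forall>Q. int_poly n d d Q \<longrightarrow>
    (\<exists>\<V>. (\<forall>V\<in>\<V>. block_hj_subspace n m V) \<and>
         (\<forall>V\<in>\<V>. \<forall>W\<in>\<V>. V \<noteq> W \<longrightarrow> V \<inter> W = {}) \<and>
         prob_cube n (cube n - \<Union>\<V>) \<le> \<eta> \<and>
         (\<forall>V\<in>\<V>. \<forall>x\<in>V. \<forall>y\<in>V. Q x = Q y)))"
proof -
  have "(2::nat) ^ d > 0" by simp
  from constant_cover[OF \<open>\<eta> > 0\<close> this, of m d]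
  obtain n0 where n0: "\<forall>n\<ge>n0. \<forall>coef. \<exists>\<V>.
    (\<forall>V\<in>\<V>. \<exists>\<pi> c a. block_map n m \<pi> \<and> c \<in> cube n \<and> V = emb n \<pi> c ` cube m \<and>
       (\<forall>x\<in>V. multilinear n d coef x mod int (2 ^ d) = a)) \<and>
    pairwise disjnt \<V> \<and> real (card (cube n - \<Union>\<V>)) \<le> \<eta> * real (card (cube n))"
    by (elim exE) (rule that)
  show ?thesis
  \<comment> \<open>The successor only serves to make the threshold positive.\<close>
  proof (intro exI[of _ "Suc n0"] conjI allI impI)
    fix n :: nat and Q :: "(nat set \<Rightarrow> bool) \<Rightarrow> int"
    assume n: "Suc n0 \<le> n" and "int_poly n d d Q"
    then obtain coef where Q: "\<forall>x\<in>cube n. Q x = multilinear n d coef x mod 2 ^ d"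
      by (elim int_poly_eq_multilinear)
    from n have "n0 \<le> n" by simp
    from n0[rule_format, OF this, of coef] obtain \<V> where
      \<V>: "\<forall>V\<in>\<V>. \<exists>\<pi> c a. block_map n m \<pi> \<and> c \<in> cube n \<and> V = emb n \<pi> c ` cube m \<and>
       (\<forall>x\<in>V. multilinear n d coef x mod int (2 ^ d) = a)"
      "pairwise disjnt \<V>" "real (card (cube n - \<Union>\<V>)) \<le> \<eta> * real (card (cube n))"
      by (elim exE conjE) (rule that)
    have V_good: "block_hj_subspace n m V" "\<forall>x\<in>V. \<forall>y\<in>V. Q x = Q y" if V: "V \<in> \<V>" for V
    proof -
      from bspec[OF \<V>(1) V] obtain \<pi> c a where
        \<pi>: "block_map n m \<pi>" "c \<in> cube n" "V = emb n \<pi> c ` cube m"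
        "\<forall>x\<in>V. multilinear n d coef x mod int (2 ^ d) = a"
        by (elim exE conjE) (rule that)
      show "block_hj_subspace n m V"
        unfolding \<pi>(3) using \<open>m > 0\<close> by (intro block_hj_subspace_emb \<pi>) simp
      have "V \<subseteq> cube n" using \<pi>(2,3) emb_in_cube by blast
      then have "Q x = a" if "x \<in> V" for x using Q \<pi>(4) that by auto
      then show "\<forall>x\<in>V. \<forall>y\<in>V. Q x = Q y" by simp
    qed
    have "\<forall>V\<in>\<V>. block_hj_subspace n m V" "\<forall>V\<in>\<V>. \<forall>x\<in>V. \<forall>y\<in>V. Q x = Q y"
      by (rule ballI, erule V_good)+
    moreover have "\<forall>V\<in>\<V>. \<forall>W\<in>\<V>. V \<noteq> W \<longrightarrow> V \<inter> W = {}"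
      using \<V>(2) by (simp add: pairwise_def disjnt_def)
    moreover have "prob_cube n (cube n - \<Union>\<V>) \<le> \<eta>"
    proof -
      have "(cube n - \<Union>\<V>) \<inter> cube n = cube n - \<Union>\<V>" by auto
      then show ?thesis using \<V>(3) by (simp add: prob_cube_def card_cube divide_le_eq)
    qed
    ultimately show "\<exists>\<V>. (\<forall>V\<in>\<V>. block_hj_subspace n m V) \<and>
         (\<forall>V\<in>\<V>. \<forall>W\<in>\<V>. V \<noteq> W \<longrightarrow> V \<inter> W = {}) \<and>
         prob_cube n (cube n - \<Union>\<V>) \<le> \<eta> \<and>
         (\<forall>V\<in>\<V>. \<forall>x\<in>V. \<forall>y\<in>V. Q x = Q y)"
      by (intro exI[of _ \<V>] conjI)
  qed simp
qed

end
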